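(* Let $G$ be a finite simple undirected graph with at least one vertex, and let $$f(G)=\max\{|I|-\delta_G(I)+1 \mid I \text{ is a nonempty independent set of } G\},$$ where $\delta_G(I)$ denotes the minimum of the degrees $d_G(v)$ over all $v\in I$. Then $G$ has a pseudo 2-factor with at most $\max\{0,f(G)\}$ non-cycle components.
   Context: All graphs are simple, finite, and undirected. $K_n$ denotes the complete graph on $n$ vertices. A pseudo 2-factor of a graph $G$ is a spanning subgraph of $G$ (not necessarily induced) in which each connected component is isomorphic to $K_1$, $K_2$, or a cycle (a cycle has at least 3 vertices). A component of a pseudo 2-factor is called a non-cycle component if it is isomorphic to $K_1$ or $K_2$. $d_G(v)$ is the degree of $v$ in $G$ (the degree in the whole graph $G$). An independent set of $G$ is a set of pairwise non-adjacent vertices. *)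

theory Defs
  imports "Graph_Theory.Graph_Theory"
begin

text \<open>
  A finite simple undirected graph is an instance of the locale \<^locale>\<open>graph\<close>: a finite
  loop-free symmetric digraph without parallel arcs, where an undirected edge $uv$ is represented
  by the two arcs $(u,v)$ and $(v,u)$.  For such graphs
    \<^item> \<^const>\<open>spanning\<close> (between two graphs) is the usual notion of a spanning subgraph, which need
      not be induced;
    \<^item> the strongly connected components \<^const>\<open>pre_digraph.sccs\<close> (as subgraphs) are the connected
      components;
    \<^item> \<^term>\<open>out_degree G v\<close> counts the neighbours of \<open>v\<close>, i.e. it is the degree of \<open>v\<close> in \<open>G\<close>;
    \<^item> \<^term>\<open>complete_digraph n G\<close> says that \<open>G\<close> is isomorphic to $K_n$.
\<close>

definition independent_set :: "('a, 'b) pre_digraph \<Rightarrow> 'a set \<Rightarrow> bool" where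
  "independent_set G I \<longleftrightarrow> I \<subseteq> verts G \<and> pairwise (\<lambda>u v. \<not> u \<rightarrow>\<^bsub>G\<^esub> v) I"

definition min_degree_on :: "('a, 'b) pre_digraph \<Rightarrow> 'a set \<Rightarrow> nat" where
  "min_degree_on G I = Min (out_degree G ` I)"

text \<open>The maximum is over a finite set, which is nonempty as soon as \<open>G\<close> has a vertex; it may be negative.\<close>

definition f_param :: "('a, 'b) pre_digraph \<Rightarrow> int" where
  "f_param G = Max {int (card I) - int (min_degree_on G I) + 1 | I. I \<noteq> {} \<and> independent_set G I}"

definition cycle_graph :: "nat \<Rightarrow> nat pair_pre_digraph" where
  "cycle_graph n = \<lparr> pverts = {..<n},
     parcs = {(i, j). i < n \<and> j < n \<and> (j = Suc i mod n \<or> i = Suc j mod n)} \<rparr>"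

definition is_cycle_graph :: "('a, 'b) pre_digraph \<Rightarrow> bool" where
  "is_cycle_graph C \<longleftrightarrow> (\<exists>n\<ge>3. digraph_iso C (with_proj (cycle_graph n)))"

definition pseudo_2_factor :: "('a, 'b) pre_digraph \<Rightarrow> ('a, 'b) pre_digraph \<Rightarrow> bool" where
  "pseudo_2_factor H G \<longleftrightarrow> graph H \<and> spanning H G \<and>
     (\<forall>C \<in> pre_digraph.sccs H.
        complete_digraph 1 C \<or> complete_digraph 2 C \<or> is_cycle_graph C)"

definition non_cycle_components :: "('a, 'b) pre_digraph \<Rightarrow> ('a, 'b) pre_digraph set" where
  "non_cycle_components H =
     {C \<in> pre_digraph.sccs H. complete_digraph 1 C \<or> complete_digraph 2 C}"

end

theory Submission
  imports Defs
begin

text \<open>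
  Call a set \<open>U\<close> of vertices a remainder if the other vertices can be partitioned into cycles, and let
  \<open>alpha U\<close> be the independence number of the subgraph induced by \<open>U\<close>.  Posa's argument (the end of a
  longest path, its farthest neighbour on the path, the cycle they close) splits \<open>U\<close> into at most
  \<open>alpha U\<close> cycles, edges and single vertices.  Hence a remainder with the smallest possible value
  \<open>k = alpha U\<close>, called optimal, gives a pseudo 2-factor with at most \<open>k\<close> non-cycle components, and
  it remains to find an independent set \<open>I\<close> and a vertex \<open>v\<close> in \<open>I\<close> with
  \<open>card I \<ge> k - 1 + d(v)\<close>: the minimum degree over \<open>I\<close> is at most \<open>d(v)\<close>, so that \<open>f(G) \<ge> k\<close>.

  The vertex \<open>v\<close> is chosen in \<open>U\<close> with at most one neighbour in \<open>U\<close>; its other neighbours lie on the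
  cycles outside \<open>U\<close>.  From each such neighbour \<open>z\<close> one walks along its cycle and collects vertices
  until \<open>U\<close> together with the collected vertices has independence number \<open>k + 1\<close>.  These gains of different
  neighbours \<open>z\<close>, \<open>z'\<close> add up: if the two collected sets were connected through \<open>U\<close>, then the
  connection, the path \<open>z, v, z'\<close> and the stretches that the two walks have not used up would form a
  cycle.  Exchanging it for the old cycles through \<open>z\<close> and \<open>z'\<close> would contradict the choice of \<open>U\<close>.  So there is an
  independent set of size \<open>k\<close> plus the number of gains that contains \<open>v\<close>
  (\<open>independent_set_from_gains\<close>).

  A neighbour without gain is called absorbing.  It suffices that \<open>v\<close> has at most one neighbour that is
  absorbing or lies in \<open>U\<close>, and this is arranged by the choice of \<open>U\<close> and \<open>v\<close>.  An optimal remainder has at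
  most \<open>2 k\<close> vertices (\<open>tight_card_le\<close>).  If all optimal remainders have exactly \<open>2 k\<close> vertices, then
  parity excludes the dangerous exchanges, and absorbing neighbours do not exist (\<open>balanced_case\<close>).
  Otherwise let \<open>U\<close> be a largest optimal remainder with fewer than \<open>2 k\<close> vertices.  It has a vertex \<open>v\<close>
  of degree at most one in \<open>U\<close> that lies in all maximum independent sets of \<open>U\<close>, which excludes the
  exchanges; and because of the maximality of \<open>U\<close>, at most one cycle is absorbed at the component
  of \<open>v\<close>, and it hangs on that component by a single edge.  If necessary one passes to another such vertex
  of the component (\<open>unbalanced_case\<close>).
\<close>

section \<open>Independence numbers of vertex sets\<close>

text \<open>
  The combinatorial part only speaks of vertices and adjacency, so it is carried out for a bare symmetric
  relation; arcs reappear when the factor is built.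
\<close>

locale finite_simple_graph =
  fixes V :: "'a set" and adj :: "'a \<Rightarrow> 'a \<Rightarrow> bool"
  assumes finite_V: "finite V"
    and adj_sym: "adj x y \<Longrightarrow> adj y x"
    and adj_irrefl: "\<not> adj x x"
    and adj_in_V: "adj x y \<Longrightarrow> x \<in> V"
begin

lemma adj_commute: "adj x y \<longleftrightarrow> adj y x"
  using adj_sym by blast

definition indep :: "'a set \<Rightarrow> bool" where
  "indep I \<longleftrightarrow> (\<forall>x\<in>I. \<forall>y\<in>I. \<not> adj x y)"

text \<open>
  Only vertices in \<open>V\<close> count.  This makes the number meaningful for every set, without a finiteness
  condition.
\<close>

definition alpha :: "'a set \<Rightarrow> nat" where
  "alpha X = Max (card ` {I. I \<subseteq> X \<inter> V \<and> indep I})"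

definition detached :: "'a set \<Rightarrow> 'a set \<Rightarrow> bool" where
  "detached X Y \<longleftrightarrow> X \<inter> Y = {} \<and> (\<forall>x\<in>X. \<forall>y\<in>Y. \<not> adj x y)"

lemma finite_alpha_set: "finite (card ` {I. I \<subseteq> X \<inter> V \<and> indep I})"
proof -
  have "{I. I \<subseteq> X \<inter> V \<and> indep I} \<subseteq> Pow V" by auto
  then show ?thesis using finite_V by (meson finite_Pow_iff finite_imageI finite_subset)
qed

lemma card_le_alpha:
  assumes "I \<subseteq> X" "I \<subseteq> V" "indep I"
  shows "card I \<le> alpha X"
  unfolding alpha_def using assms by (intro Max_ge finite_alpha_set) auto

lemma alpha_witness:
  obtains I where "I \<subseteq> X" "I \<subseteq> V" "finite I" "indep I" "card I = alpha X"
proof -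
  have "{} \<in> {I. I \<subseteq> X \<inter> V \<and> indep I}" by (auto simp: indep_def)
  then have "card ` {I. I \<subseteq> X \<inter> V \<and> indep I} \<noteq> {}" by blast
  from Max_in[OF finite_alpha_set this]
  obtain I where "I \<subseteq> X \<inter> V" "indep I" "card I = alpha X" unfolding alpha_def by auto
  moreover from this have "finite I" using finite_V by (meson finite_subset le_infE)
  ultimately show ?thesis using that by blast
qed

lemma alpha_leI:
  assumes "\<And>I. I \<subseteq> X \<Longrightarrow> I \<subseteq> V \<Longrightarrow> finite I \<Longrightarrow> indep I \<Longrightarrow> card I \<le> n"
  shows "alpha X \<le> n"
  by (metis alpha_witness assms)

lemma indep_subset: "indep I \<Longrightarrow> J \<subseteq> I \<Longrightarrow> indep J"
  by (auto simp: indep_def)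

lemma alpha_mono: "X \<subseteq> Y \<Longrightarrow> alpha X \<le> alpha Y"
  by (rule alpha_leI) (meson card_le_alpha order_trans)

lemma alpha_empty [simp]: "alpha {} = 0"
  by (metis alpha_witness card.empty subset_empty)

lemma alpha_Un_le: "alpha (X \<union> Y) \<le> alpha X + alpha Y"
proof (rule alpha_leI)
  fix I assume I: "I \<subseteq> X \<union> Y" "I \<subseteq> V" "finite I" "indep I"
  have "card I \<le> card (I \<inter> X) + card (I \<inter> Y)"
  proof -
    have "I = (I \<inter> X) \<union> (I \<inter> Y)" using I by auto
    then show ?thesis by (metis card_Un_le)
  qed
  also have "\<dots> \<le> alpha X + alpha Y"
    using I by (intro add_mono card_le_alpha) (auto intro: indep_subset)
  finally show "card I \<le> alpha X + alpha Y" .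
qed

lemma alpha_Un_detached:
  assumes "detached X Y"
  shows "alpha (X \<union> Y) = alpha X + alpha Y"
proof (rule antisym)
  obtain I where I: "I \<subseteq> X" "I \<subseteq> V" "finite I" "indep I" "card I = alpha X" by (rule alpha_witness)
  obtain J where J: "J \<subseteq> Y" "J \<subseteq> V" "finite J" "indep J" "card J = alpha Y" by (rule alpha_witness)
  have "indep (I \<union> J)"
    using I J assms unfolding indep_def detached_def by (blast dest: adj_sym)
  then have "card (I \<union> J) \<le> alpha (X \<union> Y)" using I J by (intro card_le_alpha) auto
  moreover have "card (I \<union> J) = card I + card J"
    using I J assms by (intro card_Un_disjoint) (auto simp: detached_def)
  ultimately show "alpha X + alpha Y \<le> alpha (X \<union> Y)" using I J by simp
qed (rule alpha_Un_le)

lemma alpha_clique: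
  assumes "\<And>x y. x \<in> X \<Longrightarrow> y \<in> X \<Longrightarrow> x \<noteq> y \<Longrightarrow> adj x y"
  shows "alpha X \<le> 1"
proof (rule alpha_leI)
  fix I assume "I \<subseteq> X" "finite I" "indep I"
  then show "card I \<le> 1" using assms unfolding indep_def
    by (metis One_nat_def card_le_Suc0_iff_eq subset_eq)
qed

lemma alpha_singleton: "v \<in> V \<Longrightarrow> alpha {v} = 1"
proof (rule antisym)
  assume "v \<in> V"
  then have "card {v} \<le> alpha {v}" by (intro card_le_alpha) (auto simp: indep_def adj_irrefl)
  then show "1 \<le> alpha {v}" by simp
qed (rule alpha_clique, auto)

lemma alpha_insert_free:
  assumes "v \<in> V" "v \<notin> X" "\<And>x. x \<in> X \<Longrightarrow> \<not> adj v x"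
  shows "alpha (insert v X) = alpha X + 1"
proof -
  have "detached {v} X" using assms by (auto simp: detached_def)
  from alpha_Un_detached[OF this] show ?thesis using alpha_singleton assms by simp
qed

lemma detached_commute: "detached X Y \<longleftrightarrow> detached Y X"
  unfolding detached_def using adj_sym by blast

lemma detached_Un_right: "detached X Y \<Longrightarrow> detached X Z \<Longrightarrow> detached X (Y \<union> Z)"
  unfolding detached_def by blast

lemma detached_mono: "detached X Y \<Longrightarrow> X' \<subseteq> X \<Longrightarrow> Y' \<subseteq> Y \<Longrightarrow> detached X' Y'"
  unfolding detached_def by blast

section \<open>Paths, cycles and cycle remainders\<close>

definition simple_path :: "'a list \<Rightarrow> bool" where
  "simple_path xs \<longleftrightarrow> distinct xs \<and> successively adj xs"

definition cycle_list :: "'a list \<Rightarrow> bool" where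
  "cycle_list xs \<longleftrightarrow> simple_path xs \<and> 3 \<le> length xs \<and> adj (last xs) (hd xs) \<and> set xs \<subseteq> V"

lemma simple_path_Nil [simp]: "simple_path []" and simple_path_single [simp]: "simple_path [x]"
  by (auto simp: simple_path_def)

lemma simple_path_append:
  "simple_path (xs @ ys) \<longleftrightarrow> simple_path xs \<and> simple_path ys \<and> set xs \<inter> set ys = {}
     \<and> (xs = [] \<or> ys = [] \<or> adj (last xs) (hd ys))"
  by (auto simp: simple_path_def successively_append_iff)

lemma simple_path_Cons:
  "simple_path (x # xs) \<longleftrightarrow> simple_path xs \<and> x \<notin> set xs \<and> (xs = [] \<or> adj x (hd xs))"
  using simple_path_append[of "[x]" xs] by auto

lemma simple_path_rev [simp]: "simple_path (rev xs) \<longleftrightarrow> simple_path xs"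
proof -
  have "(\<lambda>x y. adj y x) = adj" by (intro ext) (rule adj_commute)
  then have "successively (\<lambda>x y. adj y x) xs = successively adj xs" by (rule arg_cong)
  then show ?thesis by (simp add: simple_path_def)
qed

lemma simple_path_distinct: "simple_path xs \<Longrightarrow> distinct xs"
  by (simp add: simple_path_def)

inductive cycle_coverable :: "'a set \<Rightarrow> bool" where
  cycle_coverable_empty: "cycle_coverable {}"
| cycle_coverable_Un: "cycle_list xs \<Longrightarrow> cycle_coverable X \<Longrightarrow> set xs \<inter> X = {} \<Longrightarrow> cycle_coverable (set xs \<union> X)"

lemma cycle_coverable_union: "cycle_coverable X \<Longrightarrow> cycle_coverable Y \<Longrightarrow> X \<inter> Y = {} \<Longrightarrow> cycle_coverable (X \<union> Y)"
proof (induction rule: cycle_coverable.induct)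
  case (cycle_coverable_Un xs X)
  then have "cycle_coverable (set xs \<union> (X \<union> Y))" by (intro cycle_coverable.cycle_coverable_Un) auto
  then show ?case by (simp add: Un_assoc)
qed simp

lemma cycle_coverable_cycle: "cycle_list xs \<Longrightarrow> cycle_coverable (set xs)"
  using cycle_coverable_Un[OF _ cycle_coverable_empty] by simp

definition cycle_remainder :: "'a set \<Rightarrow> bool" where
  "cycle_remainder U \<longleftrightarrow> U \<subseteq> V \<and> cycle_coverable (V - U)"

text \<open>
  The independence number is minimised instead of the number of non-cycle components, because it is
  monotone and additive over components: the effect of an exchange can be computed.
\<close>

definition optimal :: "'a set \<Rightarrow> bool" where
  "optimal U \<longleftrightarrow> cycle_remainder U \<and> (\<forall>U'. cycle_remainder U' \<longrightarrow> alpha U \<le> alpha U')"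

text \<open>
  What optimality says about the inside of \<open>U\<close>: splitting off a cycle never pays.  In contrast to
  optimality, this passes to unions of components (\<open>tight_detached\<close>) and survives the removal of isolated
  vertices and pendant edges (\<open>tight_diff_clique\<close>).
\<close>

definition tight :: "'a set \<Rightarrow> bool" where
  "tight U \<longleftrightarrow> (\<forall>xs. cycle_list xs \<longrightarrow> set xs \<subseteq> U \<longrightarrow> alpha U \<le> alpha (U - set xs))"

lemma remainder_diff:
  assumes "cycle_remainder U" "cycle_coverable X" "X \<subseteq> U" shows "cycle_remainder (U - X)"
proof -
  have "V - (U - X) = (V - U) \<union> X" using assms by (auto simp: cycle_remainder_def)
  moreover have "cycle_coverable ((V - U) \<union> X)" using assms by (intro cycle_coverable_union) (auto simp: cycle_remainder_def)
  ultimately show ?thesis using assms by (auto simp: cycle_remainder_def)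
qed

lemma optimal_exists: "\<exists>U. optimal U"
proof -
  have "cycle_remainder V" by (simp add: cycle_remainder_def cycle_coverable_empty)
  then show ?thesis unfolding optimal_def using ex_has_least_nat[of cycle_remainder V alpha] by blast
qed

lemma optimal_alpha_le: "optimal U \<Longrightarrow> cycle_remainder U' \<Longrightarrow> alpha U \<le> alpha U'"
  by (simp add: optimal_def)

lemma optimalI: "optimal U \<Longrightarrow> cycle_remainder U' \<Longrightarrow> alpha U' \<le> alpha U \<Longrightarrow> optimal U' \<and> alpha U' = alpha U"
  by (metis optimal_def order_antisym order_trans)

lemma optimal_tight: "optimal U \<Longrightarrow> tight U"
  unfolding tight_def using optimal_alpha_le remainder_diff cycle_coverable_cycle optimal_def by blast

lemma tight_detached:
  assumes "tight (P \<union> Q)" "detached P Q" shows "tight P"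
  unfolding tight_def
proof (intro allI impI)
  fix xs assume xs: "cycle_list xs" "set xs \<subseteq> P"
  have "alpha (P \<union> Q) \<le> alpha ((P \<union> Q) - set xs)" using assms xs by (auto simp: tight_def)
  also have "(P \<union> Q) - set xs = (P - set xs) \<union> Q" using xs assms by (auto simp: detached_def)
  also have "alpha \<dots> \<le> alpha (P - set xs) + alpha Q" by (rule alpha_Un_le)
  finally show "alpha P \<le> alpha (P - set xs)" using alpha_Un_detached[OF assms(2)] by simp
qed

section \<open>Longest paths and tight sets\<close>

definition nbrs_in :: "'a set \<Rightarrow> 'a \<Rightarrow> 'a set" where
  "nbrs_in U v = {u\<in>U. adj v u}"

text \<open>
  Posa's argument.  All neighbours in \<open>U\<close> of the end \<open>v\<close> of a longest path lie on the path, and the part of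
  the path up to the farthest of them is closed by an edge.  One end of the path is kept at \<open>v0\<close>, so that
  the other end is a different vertex unless \<open>v0\<close> is isolated.
\<close>

lemma closed_nbhd_of_path_end:
  assumes U: "U \<subseteq> V" and v0: "v0 \<in> U"
  obtains v X where "v \<in> X" "X \<subseteq> U" "nbrs_in U v \<subseteq> X" "v \<noteq> v0 \<or> X = {v}"
    "X = {v} \<or> (\<exists>p. adj v p \<and> X = {v, p}) \<or> (\<exists>xs. cycle_list xs \<and> set xs = X)"
proof -
  let ?P = "\<lambda>xs. xs \<noteq> [] \<and> simple_path xs \<and> set xs \<subseteq> U \<and> last xs = v0"
  have fin: "finite U" using U finite_V finite_subset by blast
  have "\<exists>xs. ?P xs \<and> (\<forall>ys. ?P ys \<longrightarrow> length ys \<le> length xs)"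
  proof -
    have "?P [v0]" using v0 by simp
    moreover have "\<forall>ys. ?P ys \<longrightarrow> length ys < Suc (card U)"
      using fin by (metis card_mono distinct_card simple_path_distinct less_Suc_eq_le)
    ultimately show ?thesis by (rule ex_has_greatest_nat)
  qed
  then obtain xs where xs: "?P xs" and mx: "\<And>ys. ?P ys \<Longrightarrow> length ys \<le> length xs" by blast
  from xs obtain v zs where vz: "xs = v # zs" by (cases xs) auto
  have nb: "u \<in> set xs" if "u \<in> U" "adj v u" for u
  proof (rule ccontr)
    assume "u \<notin> set xs"
    then have "?P (u # xs)" using xs vz that adj_sym by (auto simp: simple_path_Cons)
    from mx[OF this] show False by simp
  qed
  show ?thesis
  proof (cases "\<exists>u\<in>U. adj v u")
    case False
    then have "nbrs_in U v \<subseteq> {v}" by (auto simp: nbrs_in_def)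
    then show ?thesis using that[of v "{v}"] xs vz by auto
  next
    case True
    then have "\<exists>u\<in>set xs. adj v u" using nb by blast
    then obtain as y bs where sp: "xs = as @ y # bs" "adj v y" "\<forall>z\<in>set bs. \<not> adj v z"
      using split_list_last_prop[of xs "adj v"] by metis
    have "as \<noteq> []" using sp vz adj_irrefl by (cases as) auto
    then obtain as' where as': "as = v # as'" using vz sp by (cases as) auto
    have lp: "simple_path (as @ [y])" using xs sp simple_path_append[of "as @ [y]" bs] by simp
    have "v \<noteq> v0"
      using xs sp as' by (auto simp: simple_path_Cons split: if_splits)
    moreover have "nbrs_in U v \<subseteq> set (as @ [y])"
      using nb sp by (auto simp: nbrs_in_def)
    moreover have "set (as @ [y]) = {v, y} \<or> (\<exists>xs. cycle_list xs \<and> set xs = set (as @ [y]))"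
    proof (cases as')
      case (Cons a l)
      then have "cycle_list (as @ [y])"
        using lp sp as' xs U by (auto simp: cycle_list_def adj_commute)
      then show ?thesis by blast
    qed (use as' in auto)
    ultimately show ?thesis
      using that[of v "set (as @ [y])"] xs sp as' by auto
  qed
qed

text \<open>
  Every independent set of what remains can be enlarged by \<open>v\<close>.
\<close>

lemma alpha_diff_closed_nbhd:
  assumes "v \<in> X" "v \<in> U" "U \<subseteq> V" "nbrs_in U v \<subseteq> X"
  shows "alpha (U - X) + 1 \<le> alpha U"
proof -
  have "alpha (insert v (U - X)) = alpha (U - X) + 1"
    using assms by (intro alpha_insert_free) (auto simp: nbrs_in_def)
  moreover have "insert v (U - X) \<subseteq> U" using assms by auto
  ultimately show ?thesis using alpha_mono by metis
qed

lemma alpha_edge: "adj v p \<Longrightarrow> alpha {v, p} \<le> 1"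
  by (rule alpha_clique) (metis adj_sym insertE singletonD)

text \<open>
  The set provided by Posa's argument cannot be a cycle, since its removal lowers \<open>alpha\<close>.
\<close>

lemma tight_has_leaf:
  assumes "tight U" "U \<subseteq> V" "v0 \<in> U"
  obtains (isolated) v where "v \<in> U" "nbrs_in U v = {}"
  | (leaf) v p where "v \<in> U" "p \<in> U" "v \<noteq> v0" "adj v p" "nbrs_in U v = {p}"
proof -
  obtain v X where vX: "v \<in> X" "X \<subseteq> U" "nbrs_in U v \<subseteq> X" "v \<noteq> v0 \<or> X = {v}"
    "X = {v} \<or> (\<exists>p. adj v p \<and> X = {v, p}) \<or> (\<exists>xs. cycle_list xs \<and> set xs = X)"
    using closed_nbhd_of_path_end[OF assms(2,3)] by metis
  have "alpha (U - X) + 1 \<le> alpha U" using alpha_diff_closed_nbhd[of v X U] vX assms by blast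
  then have "\<not> (\<exists>xs. cycle_list xs \<and> set xs = X)" using assms vX unfolding tight_def by fastforce
  then consider "X = {v}" | p where "adj v p" "X = {v, p}" using vX by blast
  then show ?thesis
  proof cases
    case 1 then show ?thesis using isolated[of v] vX adj_irrefl by (auto simp: nbrs_in_def)
  next
    case 2
    then have "p \<noteq> v" using adj_irrefl by blast
    then have "v \<noteq> v0" using vX 2 by auto
    moreover have "v \<in> U" "p \<in> U" using vX(1,2) 2(2) by auto
    moreover have "nbrs_in U v = {p}"
      using vX(3) 2 adj_irrefl \<open>p \<in> U\<close> by (auto simp: nbrs_in_def)
    ultimately show ?thesis using leaf[of v p] 2(1) by metis
  qed
qed

text \<open>
  Removing \<open>X\<close> lowers \<open>alpha\<close> by exactly one; a cycle that pays afterwards would have paid before.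
\<close>

lemma tight_diff_clique:
  assumes "tight U" "alpha (U - X) + 1 \<le> alpha U" "alpha X \<le> 1"
  shows "tight (U - X)"
  unfolding tight_def
proof (intro allI impI)
  fix xs assume xs: "cycle_list xs" "set xs \<subseteq> U - X"
  have "alpha U \<le> alpha (U - set xs)" using assms xs by (auto simp: tight_def)
  also have "\<dots> \<le> alpha ((U - X - set xs) \<union> X)" by (rule alpha_mono) auto
  also have "\<dots> \<le> alpha (U - X - set xs) + alpha X" by (rule alpha_Un_le)
  finally show "alpha (U - X) \<le> alpha (U - X - set xs)" using assms by linarith
qed

text \<open>
  Peel off isolated vertices and pendant edges: each step removes at most two vertices and lowers
  \<open>alpha\<close> by one.
\<close>

lemma tight_card_le:
  assumes "tight U" "U \<subseteq> V" shows "card U \<le> 2 * alpha U"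
  using assms
proof (induction "card U" arbitrary: U rule: less_induct)
  case less
  have fin: "finite U" using less finite_V finite_subset by blast
  show ?case
  proof (cases "U = {}")
    case False
    then obtain v0 where "v0 \<in> U" by blast
    obtain X where X: "X \<subseteq> U" "X \<noteq> {}" "card X \<le> 2" "alpha (U - X) + 1 \<le> alpha U" "alpha X \<le> 1"
    proof (cases rule: tight_has_leaf[OF less.prems \<open>v0 \<in> U\<close>, case_names isolated leaf])
      case (isolated v)
      have 1: "alpha {v} \<le> 1" by (rule alpha_clique) auto
      have 2: "alpha (U - {v}) + 1 \<le> alpha U"
        by (rule alpha_diff_closed_nbhd[of v]) (use isolated less.prems(2) in auto)
      show ?thesis by (rule that[OF _ _ _ 2 1]) (use isolated in simp_all)
    next
      case (leaf v p)
      have 1: "alpha {v, p} \<le> 1" by (rule alpha_edge) fact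
      have 2: "alpha (U - {v, p}) + 1 \<le> alpha U"
        by (rule alpha_diff_closed_nbhd[of v]) (use leaf less.prems(2) in auto)
      show ?thesis by (rule that[OF _ _ _ 2 1]) (use leaf in \<open>simp_all add: card_insert_if\<close>)
    qed
    have fX: "finite X" using X fin finite_subset by blast
    have c: "card U = card (U - X) + card X" using X fin fX
      by (metis card_Diff_subset card_mono le_add_diff_inverse2)
    moreover have "card X > 0" using X fX by (simp add: card_gt_0_iff)
    ultimately have "card (U - X) \<le> 2 * alpha (U - X)"
      using less.hyps[of "U - X"] tight_diff_clique[OF less.prems(1) X(4,5)] less.prems by auto
    then show ?thesis using c X by linarith
  qed simp
qed

text \<open>
  If peeling off pendant edges does not exhaust \<open>U\<close> in pairs, it meets an isolated vertex, and some vertex of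
  degree at most one belongs to every maximum independent set of \<open>U\<close>.  The vertex \<open>v0\<close> is excluded, unless it
  is isolated, in order to obtain a second vertex of this kind from a first one.
\<close>

lemma tight_critical_leaf:
  assumes "tight U" "U \<subseteq> V" "card U \<noteq> 2 * alpha U" "v0 \<in> U"
  shows "\<exists>w\<in>U. alpha (U - {w}) < alpha U \<and> card (nbrs_in U w) \<le> 1 \<and> (w \<noteq> v0 \<or> nbrs_in U w = {})"
  using assms
proof (induction "card U" arbitrary: U v0 rule: less_induct)
  case less
  have fin: "finite U" using less finite_V finite_subset by blast
  show ?case
  proof (cases rule: tight_has_leaf[OF less.prems(1,2,4), case_names isolated leaf])
    case (isolated v)
    then have "alpha (U - {v}) + 1 \<le> alpha U"
      using less.prems by (intro alpha_diff_closed_nbhd[of v]) auto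
    then show ?thesis using isolated by (intro bexI[of _ v]) auto
  next
    case (leaf v p)
    have vp: "v \<noteq> p" using leaf adj_irrefl by blast
    show ?thesis
    proof (cases "alpha (U - {v}) < alpha U")
      case True
      then show ?thesis using leaf by (intro bexI[of _ v]) auto
    next
      case False
      let ?U = "U - {v, p}"
      have a1: "alpha {v, p} \<le> 1" by (rule alpha_edge) fact
      have a2: "alpha ?U + 1 \<le> alpha U"
        by (rule alpha_diff_closed_nbhd[of v]) (use leaf less.prems(2) in auto)
      have "alpha U \<le> alpha ?U + alpha {v, p}"
        by (rule order_trans[OF alpha_mono alpha_Un_le]) auto
      then have a3: "alpha U = alpha ?U + 1" using a1 a2 by linarith
      have t: "tight ?U" by (rule tight_diff_clique[OF less.prems(1) a2 a1])
      have "card ?U = card U - 2" using leaf fin vp by (simp add: card_Diff_subset)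
      moreover have "card U \<ge> 2" using leaf fin vp
        by (metis card_2_iff card_mono empty_subsetI insert_subset)
      ultimately have c: "card U = card ?U + 2" by simp
      then have ne: "card ?U \<noteq> 2 * alpha ?U" using a3 less.prems by simp
      then have "?U \<noteq> {}" by (metis alpha_empty card.empty mult_0_right)
      then obtain v1 where v1: "v1 \<in> ?U" "v0 \<in> ?U \<longrightarrow> v1 = v0" by (cases "v0 \<in> ?U") auto
      obtain w where w: "w \<in> ?U" "alpha (?U - {w}) < alpha ?U" "card (nbrs_in ?U w) \<le> 1"
        "w \<noteq> v1 \<or> nbrs_in ?U w = {}"
        using less.hyps[of ?U v1] t less.prems ne v1 c by auto
      \<comment> \<open>If \<open>w\<close> were adjacent to \<open>p\<close>, then a maximum independent set avoiding \<open>v\<close> would contain \<open>p\<close>, hence not \<open>w\<close>,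
        and would be too small.\<close>
      have wp: "\<not> adj w p"
      proof
        assume adj: "adj w p"
        obtain J where J: "J \<subseteq> U - {v}" "J \<subseteq> V" "finite J" "indep J" "card J = alpha (U - {v})"
          by (rule alpha_witness)
        have "card (J - {p}) \<le> alpha (?U - {w}) \<or> p \<notin> J"
        proof (cases "p \<in> J")
          case True
          then have "w \<notin> J" using J adj unfolding indep_def by blast
          then have "card (J - {p}) \<le> alpha (?U - {w})"
            using J by (intro card_le_alpha) (auto intro: indep_subset)
          then show ?thesis by simp
        qed simp
        moreover have "card J \<le> alpha ?U" if "p \<notin> J"
          using J that by (intro card_le_alpha) auto
        moreover have "card J \<le> card (J - {p}) + 1"
          using J(3) card.remove[of J p] by (cases "p \<in> J") auto
        ultimately have "card J < alpha U" using w a3 by auto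
        then show False using False J by simp
      qed
      have wv: "\<not> adj w v" using leaf(5) w(1) adj_sym[of w v] by (auto simp: nbrs_in_def)
      have n: "nbrs_in U w = nbrs_in ?U w" using wp wv by (auto simp: nbrs_in_def)
      have "alpha (U - {w}) \<le> alpha (?U - {w}) + alpha {v, p}"
        by (rule order_trans[OF alpha_mono alpha_Un_le]) auto
      then have "alpha (U - {w}) < alpha U" using a1 a3 w by linarith
      moreover have "w \<noteq> v0 \<or> nbrs_in U w = {}" using w v1 n by auto
      ultimately show ?thesis using w n by (intro bexI[of _ w]) auto
    qed
  qed
qed

end

section \<open>Components and links\<close>

context finite_simple_graph begin

definition joined :: "'a set \<Rightarrow> 'a \<Rightarrow> 'a \<Rightarrow> bool" where
  "joined U u w \<longleftrightarrow> (\<exists>xs. xs \<noteq> [] \<and> simple_path xs \<and> set xs \<subseteq> U \<and> hd xs = u \<and> last xs = w)"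

definition component :: "'a set \<Rightarrow> 'a \<Rightarrow> 'a set" where
  "component U v = {t. joined U v t}"

lemma joined_refl: "u \<in> U \<Longrightarrow> joined U u u"
  unfolding joined_def by (intro exI[of _ "[u]"]) auto

lemma joined_step:
  assumes "joined U u w" "adj w x" "x \<in> U" shows "joined U u x"
proof -
  obtain xs where xs: "xs \<noteq> []" "simple_path xs" "set xs \<subseteq> U" "hd xs = u" "last xs = w"
    using assms(1) by (auto simp: joined_def)
  show ?thesis
  proof (cases "x \<in> set xs")
    case True
    then obtain ys zs where sp: "xs = ys @ x # zs" by (meson split_list)
    then have "simple_path (ys @ [x])" using xs(2) simple_path_append[of "ys @ [x]" zs] by simp
    moreover have "hd (ys @ [x]) = u" using sp xs by (cases ys) auto
    ultimately show ?thesis unfolding joined_def using sp xs by (intro exI[of _ "ys @ [x]"]) auto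
  next
    case False
    then have "simple_path (xs @ [x])" using xs assms by (simp add: simple_path_append)
    then show ?thesis unfolding joined_def using xs assms by (intro exI[of _ "xs @ [x]"]) auto
  qed
qed

lemma component_subset: "component U v \<subseteq> U"
  by (auto simp: component_def joined_def)

lemma component_self: "v \<in> U \<Longrightarrow> v \<in> component U v"
  by (simp add: component_def joined_refl)

lemma component_closed: "t \<in> component U v \<Longrightarrow> adj t x \<Longrightarrow> x \<in> U \<Longrightarrow> x \<in> component U v"
  by (auto simp: component_def intro: joined_step)

lemma detached_component: "detached (component U v) (U - component U v)"
  using component_closed by (auto simp: detached_def)

lemma nbrs_in_component: "t \<in> component U v \<Longrightarrow> nbrs_in (component U v) t = nbrs_in U t"
  using component_closed[of t U v] component_subset[of U v] by (auto simp: nbrs_in_def)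

lemma simple_path_in_closed:
  assumes "simple_path xs" "set xs \<subseteq> U" "set xs \<inter> S \<noteq> {}"
    "\<And>x y. x \<in> S \<Longrightarrow> y \<in> U \<Longrightarrow> adj x y \<Longrightarrow> y \<in> S"
  shows "set xs \<subseteq> S"
  using assms(1-3)
proof (induction xs)
  case (Cons x xs)
  show ?case
  proof (cases "xs = []")
    case False
    then have a: "adj x (hd xs)" "hd xs \<in> set xs" using Cons.prems by (auto simp: simple_path_Cons)
    have "set xs \<inter> S \<noteq> {}"
    proof (cases "x \<in> S")
      case True
      then show ?thesis using assms(4)[OF True _ a(1)] a(2) Cons.prems by auto
    qed (use Cons.prems in auto)
    then have "set xs \<subseteq> S" using Cons by (auto simp: simple_path_Cons)
    moreover from this have "x \<in> S" using assms(4)[of "hd xs" x] a Cons.prems adj_sym by auto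
    ultimately show ?thesis by simp
  qed (use Cons.prems in auto)
qed simp

lemma component_sym: "t \<in> component U v \<Longrightarrow> v \<in> component U t"
proof -
  assume "t \<in> component U v"
  then obtain xs where "xs \<noteq> []" "simple_path xs" "set xs \<subseteq> U" "hd xs = v" "last xs = t"
    by (auto simp: component_def joined_def)
  then show ?thesis unfolding component_def joined_def mem_Collect_eq
    by (intro exI[of _ "rev xs"]) (auto simp: hd_rev last_rev)
qed

lemma component_eq:
  assumes "t \<in> component U v" shows "component U t = component U v"
proof -
  have sub: "component U b \<subseteq> component U a" if "b \<in> component U a" for a b
  proof
    fix x assume "x \<in> component U b"
    then obtain xs where xs: "xs \<noteq> []" "simple_path xs" "set xs \<subseteq> U" "hd xs = b" "last xs = x"
      by (auto simp: component_def joined_def)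
    have "set xs \<subseteq> component U a"
      by (rule simple_path_in_closed[OF xs(2,3)]) (use xs that hd_in_set component_closed in blast)+
    then show "x \<in> component U a" using xs last_in_set by blast
  qed
  show ?thesis using sub assms component_sym by blast
qed

text \<open>
  The first two disjuncts are the paths of length zero and one from \<open>r\<close> to \<open>s\<close>; the inner vertices of
  longer paths are required to lie in \<open>U\<close>.
\<close>

definition linked :: "'a set \<Rightarrow> 'a \<Rightarrow> 'a \<Rightarrow> bool" where
  "linked U r s \<longleftrightarrow> r = s \<or> adj r s \<or>
     (\<exists>xs. xs \<noteq> [] \<and> simple_path xs \<and> set xs \<subseteq> U \<and> adj r (hd xs) \<and> adj (last xs) s)"

definition unlinked :: "'a set \<Rightarrow> 'a set \<Rightarrow> 'a set \<Rightarrow> bool" where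
  "unlinked U A B \<longleftrightarrow> (\<forall>r\<in>A. \<forall>s\<in>B. \<not> linked U r s)"

text \<open>
  \<open>D\<close> is the part of \<open>U\<close> that can be reached from \<open>A\<close> inside \<open>U\<close>.
\<close>

lemma unlinked_split:
  assumes "unlinked U A B" "A \<inter> U = {}" "B \<inter> U = {}"
  obtains D where "D \<subseteq> U" "detached (D \<union> A) ((U - D) \<union> B)"
proof -
  define D where "D = {w. \<exists>u\<in>U. \<exists>r\<in>A. adj r u \<and> joined U u w}"
  have sub: "D \<subseteq> U" by (auto simp: D_def joined_def)
  have "\<not> adj x y" if "x \<in> D \<union> A" "y \<in> (U - D) \<union> B" for x y
  proof
    assume xy: "adj x y"
    consider "x \<in> D" "y \<in> U - D" | "x \<in> A" "y \<in> U - D" | "x \<in> A" "y \<in> B" | "x \<in> D" "y \<in> B"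
      using \<open>x \<in> D \<union> A\<close> \<open>y \<in> (U - D) \<union> B\<close> by blast
    then show False
    proof cases
      case 1 then show False using joined_step[of U _ x y] xy by (auto simp: D_def)
    next
      case 2 then show False using xy joined_refl[of y U] by (auto simp: D_def)
    next
      case 3 then show False using assms(1) xy by (auto simp: unlinked_def linked_def)
    next
      case 4
      then obtain u r where "r \<in> A" "adj r u" "joined U u x" by (auto simp: D_def)
      then have "linked U r y" using xy by (auto simp: joined_def linked_def)
      then show False using assms(1) \<open>r \<in> A\<close> 4 by (auto simp: unlinked_def)
    qed
  qed
  moreover have "A \<inter> B = {}" using assms(1) by (auto simp: unlinked_def linked_def)
  ultimately have "detached (D \<union> A) ((U - D) \<union> B)"
    using assms sub unfolding detached_def by blast
  then show ?thesis using that sub by blast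
qed

lemma detached_alpha_modular:
  assumes "D \<subseteq> U" "detached (D \<union> A) ((U - D) \<union> B)"
  shows "alpha (U \<union> A \<union> B) + alpha U = alpha (U \<union> A) + alpha (U \<union> B)"
proof -
  have e: "U \<union> A \<union> B = (D \<union> A) \<union> ((U - D) \<union> B)" "U \<union> A = (D \<union> A) \<union> (U - D)"
    "U \<union> B = D \<union> ((U - D) \<union> B)" "D \<union> (U - D) = U" using assms(1) by auto
  have d: "detached (D \<union> A) (U - D)" "detached D ((U - D) \<union> B)" "detached D (U - D)"
    by (rule detached_mono[OF assms(2)]; blast)+
  have "alpha (U \<union> A \<union> B) = alpha (D \<union> A) + alpha ((U - D) \<union> B)"
    unfolding e(1) by (rule alpha_Un_detached[OF assms(2)])
  moreover have "alpha (U \<union> A) = alpha (D \<union> A) + alpha (U - D)"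
    unfolding e(2) by (rule alpha_Un_detached[OF d(1)])
  moreover have "alpha (U \<union> B) = alpha D + alpha ((U - D) \<union> B)"
    unfolding e(3) by (rule alpha_Un_detached[OF d(2)])
  moreover have "alpha U = alpha D + alpha (U - D)"
    using alpha_Un_detached[OF d(3)] e(4) by simp
  ultimately show ?thesis by linarith
qed

lemma unlinked_alpha:
  assumes "unlinked U A B" "A \<inter> U = {}" "B \<inter> U = {}"
  shows "alpha (U \<union> A \<union> B) + alpha U = alpha (U \<union> A) + alpha (U \<union> B)"
  using unlinked_split[OF assms] detached_alpha_modular by metis

text \<open>
  This is how the gains of the neighbours of \<open>v\<close> are added up.
\<close>

lemma unlinked_family_alpha:
  assumes "finite F" "\<And>z. z \<in> F \<Longrightarrow> S z \<inter> U = {}" "\<And>z. z \<in> F \<Longrightarrow> alpha U + 1 \<le> alpha (U \<union> S z)"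
    "\<And>z z'. z \<in> F \<Longrightarrow> z' \<in> F \<Longrightarrow> z \<noteq> z' \<Longrightarrow> unlinked U (S z) (S z')"
  shows "alpha U + card F \<le> alpha (U \<union> (\<Union>z\<in>F. S z))"
  using assms
proof (induction F rule: finite_induct)
  case (insert z F)
  let ?B = "\<Union>z\<in>F. S z"
  have "unlinked U (S z) ?B"
    using insert.prems(3)[of z] insert.hyps by (fastforce simp: unlinked_def)
  then have "alpha (U \<union> S z \<union> ?B) + alpha U = alpha (U \<union> S z) + alpha (U \<union> ?B)"
    using insert.prems(1) by (intro unlinked_alpha) auto
  moreover have "alpha U + card F \<le> alpha (U \<union> ?B)" using insert by auto
  moreover have "alpha U + 1 \<le> alpha (U \<union> S z)" using insert by auto
  moreover have "U \<union> (\<Union>z\<in>insert z F. S z) = U \<union> S z \<union> ?B" by auto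
  ultimately show ?case using insert.hyps by simp
qed simp

section \<open>Orientation of a cycle cover\<close>

lemma cycle_list_rotate:
  assumes "cycle_list (xs @ ys)" shows "cycle_list (ys @ xs)"
proof (cases "xs = [] \<or> ys = []")
  case False
  then show ?thesis using assms by (auto simp: cycle_list_def simple_path_append)
qed (use assms in auto)

text \<open>
  The list \<open>follow z\<close> runs around the cycle of \<open>z\<close>, from the successor of \<open>z\<close> to its predecessor.
  If \<open>z\<close> and \<open>z'\<close> lie on the same cycle, then \<open>A\<close> and \<open>B\<close> are the two arcs between them.  The last conjuncts allow
  one or two cycles to be taken out of the cover.
\<close>

definition oriented :: "'a set \<Rightarrow> ('a \<Rightarrow> 'a list) \<Rightarrow> bool" where
  "oriented X follow \<longleftrightarrow>
    (\<forall>z\<in>X. cycle_list (follow z @ [z]) \<and> set (follow z @ [z]) \<subseteq> X \<and> cycle_coverable (X - set (follow z @ [z]))) \<and>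
    (\<forall>z\<in>X. \<forall>z'\<in>X. z \<noteq> z' \<longrightarrow>
       (\<exists>A B. follow z = A @ z' # B \<and> follow z' = B @ z # A) \<or>
       (set (follow z @ [z]) \<inter> set (follow z' @ [z']) = {} \<and>
        cycle_coverable (X - set (follow z @ [z]) - set (follow z' @ [z']))))"

lemma cycle_coverable_oriented: "cycle_coverable X \<Longrightarrow> \<exists>follow. oriented X follow"
proof (induction rule: cycle_coverable.induct)
  case cycle_coverable_empty
  then show ?case by (auto simp: oriented_def)
next
  case (cycle_coverable_Un xs X)
  then obtain f where f: "oriented X f" by blast
  \<comment> \<open>\<open>rot z\<close> is \<open>xs\<close> rotated such that \<open>z\<close> comes last, with \<open>z\<close> removed.\<close>
  define rot where "rot z = tl (dropWhile (\<lambda>x. x \<noteq> z) xs) @ takeWhile (\<lambda>x. x \<noteq> z) xs" for z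
  define g where "g z = (if z \<in> set xs then rot z else f z)" for z
  have dist: "distinct xs" using cycle_coverable_Un by (simp add: cycle_list_def simple_path_def)
  have rot: "rot z = bs @ as" if "xs = as @ z # bs" for as bs z
  proof -
    have "\<And>x. x \<in> set as \<Longrightarrow> x \<noteq> z" using dist that by auto
    then show ?thesis unfolding rot_def that
      by (simp add: dropWhile_append2 takeWhile_append2 dropWhile_append1 takeWhile_append1)
  qed
  have g1: "cycle_list (g z @ [z]) \<and> set (g z @ [z]) = set xs" if z: "z \<in> set xs" for z
  proof -
    obtain as bs where sp: "xs = as @ z # bs" using z by (meson split_list)
    have "cycle_list (bs @ (as @ [z]))" using cycle_list_rotate[of "as @ [z]" bs] cycle_coverable_Un sp by simp
    then show ?thesis using rot[OF sp] z sp by (auto simp: g_def)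
  qed
  have g2: "g z = f z \<and> z \<notin> set xs \<and> cycle_list (f z @ [z]) \<and> set (f z @ [z]) \<subseteq> X \<and> cycle_coverable (X - set (f z @ [z]))"
    if "z \<in> X" for z
    using that f cycle_coverable_Un by (auto simp: g_def oriented_def)
  have g3: "cycle_coverable (set xs \<union> (X - Y))" if "cycle_coverable (X - Y)" for Y
    using that cycle_coverable_Un by (intro cycle_coverable.cycle_coverable_Un) auto
  have d: "set xs \<inter> X = {}" by fact
  have "oriented (set xs \<union> X) g"
    unfolding oriented_def
  proof (intro conjI ballI impI)
    fix z assume z: "z \<in> set xs \<union> X"
    show "cycle_list (g z @ [z])" "set (g z @ [z]) \<subseteq> set xs \<union> X" using z g1 g2 by fastforce+
    show "cycle_coverable (set xs \<union> X - set (g z @ [z]))"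
    proof (cases "z \<in> set xs")
      case True
      then have "set xs \<union> X - set (g z @ [z]) = X" using g1[OF True] d by auto
      then show ?thesis using cycle_coverable_Un by simp
    next
      case False
      then have zX: "z \<in> X" using z by simp
      then have "set xs \<union> X - set (g z @ [z]) = set xs \<union> (X - set (f z @ [z]))"
        using g2[OF zX] d by auto
      then show ?thesis using g2[OF zX] g3 by metis
    qed
  next
    fix z z' assume z: "z \<in> set xs \<union> X" and z': "z' \<in> set xs \<union> X" and ne: "z \<noteq> z'"
    let ?same = "\<exists>A B. g z = A @ z' # B \<and> g z' = B @ z # A"
    let ?diff = "set (g z @ [z]) \<inter> set (g z' @ [z']) = {} \<and>
        cycle_coverable (set xs \<union> X - set (g z @ [z]) - set (g z' @ [z']))"
    consider "z \<in> set xs" "z' \<in> set xs" | "z \<in> set xs" "z' \<in> X" | "z \<in> X" "z' \<in> set xs"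
      | "z \<in> X" "z' \<in> X" using z z' by blast
    then show "?same \<or> ?diff"
    proof cases
      case 1
      obtain as bs where sp: "xs = as @ z # bs" using 1 by (meson split_list)
      have "z' \<in> set as \<or> z' \<in> set bs" using 1 sp ne by auto
      then have ?same
      proof
        assume "z' \<in> set as"
        then obtain a b where ab: "as = a @ z' # b" by (meson split_list)
        have "g z = bs @ as" "g z' = (b @ z # bs) @ a"
          using 1 sp rot[OF sp] rot[of a z' "b @ z # bs"] ab by (auto simp: g_def)
        then have "g z = (bs @ a) @ z' # b \<and> g z' = b @ z # (bs @ a)" using ab by simp
        then show ?same by blast
      next
        assume "z' \<in> set bs"
        then obtain b c where bc: "bs = b @ z' # c" by (meson split_list)
        have "g z = bs @ as" "g z' = c @ as @ z # b"
          using 1 sp rot[OF sp] rot[of "as @ z # b" z' c] bc by (auto simp: g_def)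
        then have "g z = b @ z' # (c @ as) \<and> g z' = (c @ as) @ z # b" using bc by simp
        then show ?same by blast
      qed
      then show ?thesis ..
    next
      case 2
      have "set xs \<union> X - set (g z @ [z]) - set (g z' @ [z']) = X - set (f z' @ [z'])"
        using g1[OF 2(1)] g2[OF 2(2)] d by auto
      moreover have "set (g z @ [z]) = set xs" "set (g z' @ [z']) \<subseteq> X"
        using g1[OF 2(1)] g2[OF 2(2)] by simp_all
      then have "set (g z @ [z]) \<inter> set (g z' @ [z']) = {}" using d by blast
      ultimately have ?diff using g2[OF 2(2)] by metis
      then show ?thesis ..
    next
      case 3
      have "set xs \<union> X - set (g z @ [z]) - set (g z' @ [z']) = X - set (f z @ [z])"
        using g1[OF 3(2)] g2[OF 3(1)] d by auto
      moreover have "set (g z' @ [z']) = set xs" "set (g z @ [z]) \<subseteq> X"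
        using g1[OF 3(2)] g2[OF 3(1)] by simp_all
      then have "set (g z @ [z]) \<inter> set (g z' @ [z']) = {}" using d by blast
      ultimately have ?diff using g2[OF 3(1)] by metis
      then show ?thesis ..
    next
      case 4
      then have "(\<exists>A B. f z = A @ z' # B \<and> f z' = B @ z # A) \<or>
       (set (f z @ [z]) \<inter> set (f z' @ [z']) = {} \<and> cycle_coverable (X - set (f z @ [z]) - set (f z' @ [z'])))"
        using f ne unfolding oriented_def by blast
      then show ?thesis
      proof
        assume a: "set (f z @ [z]) \<inter> set (f z' @ [z']) = {} \<and> cycle_coverable (X - set (f z @ [z]) - set (f z' @ [z']))"
        have "set xs \<union> X - set (g z @ [z]) - set (g z' @ [z'])
            = set xs \<union> (X - (set (f z @ [z]) \<union> set (f z' @ [z'])))"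
          using g2[OF 4(1)] g2[OF 4(2)] d by auto
        moreover have "X - set (f z @ [z]) - set (f z' @ [z']) = X - (set (f z @ [z]) \<union> set (f z' @ [z']))"
          by blast
        then have "cycle_coverable (set xs \<union> (X - (set (f z @ [z]) \<union> set (f z' @ [z']))))" using a g3 by metis
        ultimately have ?diff using a g2[OF 4(1)] g2[OF 4(2)] by simp
        then show ?thesis ..
      qed (use g2[OF 4(1)] g2[OF 4(2)] in simp)
    qed
  qed
  then show ?case by blast
qed

text \<open>
  The ends of \<open>P1\<close> and \<open>P2\<close> are joined by \<open>p\<close>, their starts by \<open>xs\<close>; an empty \<open>xs\<close> stands for a single
  edge between the starts.
\<close>

lemma cycle_list_of_two_paths:
  assumes "simple_path P1" "simple_path P2" "simple_path p" "simple_path xs" "P1 \<noteq> []" "P2 \<noteq> []" "p \<noteq> []"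
    "set P1 \<inter> set P2 = {}" "set P1 \<inter> set p = {}" "set P2 \<inter> set p = {}"
    "set xs \<inter> set P1 = {}" "set xs \<inter> set P2 = {}" "set xs \<inter> set p = {}"
    "adj (last P1) (hd p)" "adj (last p) (last P2)"
    "xs = [] \<or> adj (hd P1) (hd xs)" "adj (last (hd P1 # xs)) (hd P2)"
    "set P1 \<union> set P2 \<union> set p \<union> set xs \<subseteq> V"
  shows "cycle_list (P1 @ p @ rev P2 @ rev xs)"
proof -
  let ?C = "P1 @ p @ rev P2 @ rev xs"
  have 1: "simple_path (P1 @ p)" using assms(1,3,9,14) by (subst simple_path_append) simp
  have "set (P1 @ p) \<inter> set (rev P2) = {}" using assms(8,10) by auto
  moreover have "adj (last (P1 @ p)) (hd (rev P2))" using assms(6,7,15) by (simp add: hd_rev)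
  ultimately have 2: "simple_path ((P1 @ p) @ rev P2)" using 1 assms(2) by (subst simple_path_append) simp
  have "set ((P1 @ p) @ rev P2) \<inter> set (rev xs) = {}" using assms(11-13) by auto
  moreover have "xs = [] \<or> adj (last ((P1 @ p) @ rev P2)) (hd (rev xs))"
  proof (cases "xs = []")
    case False
    then have "adj (hd P2) (last xs)" using adj_sym[OF assms(17)] by simp
    then show ?thesis using assms(6) False by (simp add: hd_rev last_rev)
  qed simp
  ultimately have "simple_path (((P1 @ p) @ rev P2) @ rev xs)" using 2 assms(4) by (subst simple_path_append) auto
  then have "simple_path ?C" by (simp only: append_assoc)
  moreover have "length ?C \<ge> 3"
    using assms(5-7) by (cases P1; cases P2; cases p) auto
  moreover have "adj (last ?C) (hd ?C)"
  proof (cases "xs = []")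
    case True
    then have "adj (hd P2) (hd P1)" using adj_sym[OF assms(17)] by simp
    then show ?thesis using assms(5-7) True by (simp add: last_rev)
  next
    case False
    then have "adj (hd xs) (hd P1)" using assms(16) adj_sym[of "hd P1" "hd xs"] by simp
    then show ?thesis using assms(5-7) False by (simp add: last_rev)
  qed
  moreover have "set ?C \<subseteq> V" using assms(18) by auto
  ultimately show ?thesis by (simp add: cycle_list_def)
qed

text \<open>
  The common form of all exchanges: \<open>X\<close> is the union of the cycles that are dissolved, and \<open>R\<close> is the part
  of them that the new cycles do not reach.
\<close>

lemma remainder_swap:
  assumes "cycle_remainder U" "X \<subseteq> V - U" "cycle_coverable (V - U - X)" "Y \<subseteq> U" "R \<subseteq> X" "cycle_coverable ((X - R) \<union> Y)"
  shows "cycle_remainder ((U - Y) \<union> R)"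
proof -
  have e: "V - ((U - Y) \<union> R) = (V - U - X) \<union> ((X - R) \<union> Y)"
    using assms by (auto simp: cycle_remainder_def)
  have "cycle_coverable ((V - U - X) \<union> ((X - R) \<union> Y))"
    by (rule cycle_coverable_union) (use assms in auto)
  then show ?thesis using e assms by (auto simp: cycle_remainder_def)
qed

end

section \<open>Exchanging cycles\<close>

locale optimal_remainder = finite_simple_graph +
  fixes U :: "'a set" and follow :: "'a \<Rightarrow> 'a list"
  assumes optimal_U: "optimal U" and oriented_follow: "oriented (V - U) follow"
begin

lemma remainder_U: "cycle_remainder U" and U_subset: "U \<subseteq> V" and finite_U: "finite U"
  using optimal_U finite_V finite_subset by (auto simp: optimal_def cycle_remainder_def)

lemma tight_U: "tight U"
  by (rule optimal_tight[OF optimal_U])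

lemma follow_cycle:
  assumes "z \<in> V - U"
  shows "cycle_list (follow z @ [z])" "set (follow z @ [z]) \<subseteq> V - U" "cycle_coverable (V - U - set (follow z @ [z]))"
  using assms oriented_follow by (auto simp: oriented_def)

lemma follow_two:
  assumes "z \<in> V - U" "z' \<in> V - U" "z \<noteq> z'"
  obtains (same) A B where "follow z = A @ z' # B" "follow z' = B @ z # A"
  | (diff) "set (follow z @ [z]) \<inter> set (follow z' @ [z']) = {}"
       "cycle_coverable (V - U - (set (follow z @ [z]) \<union> set (follow z' @ [z'])))"
proof -
  have e: "V - U - (set (follow z @ [z]) \<union> set (follow z' @ [z'])) = V - U - set (follow z @ [z]) - set (follow z' @ [z'])"
    by blast
  have "(\<exists>A B. follow z = A @ z' # B \<and> follow z' = B @ z # A) \<or>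
       (set (follow z @ [z]) \<inter> set (follow z' @ [z']) = {} \<and>
        cycle_coverable (V - U - set (follow z @ [z]) - set (follow z' @ [z'])))"
    using oriented_follow assms unfolding oriented_def by blast
  then show ?thesis using same diff e by metis
qed

text \<open>
  Such an exchange would lower \<open>alpha\<close>, because \<open>v\<close> can be added to every independent set of the new
  remainder without leaving \<open>U \<union> R\<close>.
\<close>

lemma swap_drop_contra:
  assumes "v \<in> Y" "Y \<subseteq> U" "nbrs_in U v \<subseteq> Y" "R \<subseteq> V - U" "\<And>r. r \<in> R \<Longrightarrow> \<not> adj v r"
    "alpha (U \<union> R) \<le> alpha U" "cycle_remainder ((U - Y) \<union> R)"
  shows False
proof -
  have "alpha (insert v ((U - Y) \<union> R)) = alpha ((U - Y) \<union> R) + 1"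
    using assms(1-5) U_subset by (intro alpha_insert_free) (auto simp: nbrs_in_def)
  moreover have "alpha (insert v ((U - Y) \<union> R)) \<le> alpha (U \<union> R)"
    using assms(1,2) by (intro alpha_mono) auto
  moreover have "alpha U \<le> alpha ((U - Y) \<union> R)" using optimal_alpha_le[OF optimal_U assms(7)] .
  ultimately show False using assms(6) by linarith
qed

lemma component_path:
  assumes "t \<in> component U v" "card (nbrs_in U v) \<le> 1"
  obtains p where "simple_path p" "p \<noteq> []" "set p \<subseteq> component U v" "hd p = v" "last p = t"
    "t \<noteq> v \<Longrightarrow> nbrs_in U v \<subseteq> set p"
proof -
  obtain p where p: "p \<noteq> []" "simple_path p" "set p \<subseteq> U" "hd p = v" "last p = t"
    using assms(1) by (auto simp: component_def joined_def)
  have vU: "v \<in> U" using p hd_in_set by blast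
  have "set p \<inter> component U v \<noteq> {}" using p component_self[OF vU] hd_in_set by blast
  then have "set p \<subseteq> component U v" by (rule simple_path_in_closed[OF p(2,3)]) (rule component_closed)
  moreover have "nbrs_in U v \<subseteq> set p" if "t \<noteq> v"
  proof -
    obtain q where q: "p = v # q" using p by (cases p) auto
    have "q \<noteq> []" using q p that by auto
    then have "hd q \<in> nbrs_in U v" using p q by (auto simp: nbrs_in_def simple_path_Cons)
    moreover have fin: "finite (nbrs_in U v)" using finite_U by (simp add: nbrs_in_def)
    have "\<forall>x\<in>nbrs_in U v. \<forall>y\<in>nbrs_in U v. x = y"
      using assms(2) card_le_Suc0_iff_eq[OF fin] by simp
    ultimately have "nbrs_in U v \<subseteq> {hd q}" by blast
    then show ?thesis using q \<open>q \<noteq> []\<close> by auto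
  qed
  ultimately show ?thesis using that p by blast
qed

text \<open>
  Suppose that the first \<open>i\<close> vertices after \<open>z\<close> on its cycle are not worth anything to \<open>alpha\<close>, and that the
  next vertex is adjacent to \<open>t\<close> in the component of \<open>v\<close>.  Then the stretch of the cycle from that vertex to \<open>z\<close>,
  followed by a path from \<open>v\<close> to \<open>t\<close>, is a cycle, and exchanging it only puts these \<open>i\<close> vertices into the
  remainder.  For \<open>i = length (follow z)\<close> the vertex in question is \<open>z\<close> itself.
\<close>

lemma component_closing:
  assumes "z \<in> V - U" "adj v z" "v \<in> U" "card (nbrs_in U v) \<le> 1" "i \<le> length (follow z)"
    "\<And>x. x \<in> set (take i (follow z)) \<Longrightarrow> \<not> adj v x"
    "alpha (U \<union> set (take i (follow z))) \<le> alpha U" "t \<in> component U v" "t \<noteq> v"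
  shows "\<not> adj t ((follow z @ [z]) ! i)"
proof
  assume adj: "adj t ((follow z @ [z]) ! i)"
  let ?L = "follow z @ [z]"
  note c = follow_cycle[OF assms(1)]
  obtain p where p: "simple_path p" "p \<noteq> []" "set p \<subseteq> component U v" "hd p = v" "last p = t"
    "nbrs_in U v \<subseteq> set p" using component_path[OF assms(8,4)] assms(9) by metis
  have pU: "set p \<subseteq> U" using p component_subset by blast
  have tk: "take i ?L = take i (follow z)" using assms(5) by simp
  have L: "simple_path (take i ?L @ drop i ?L)" using c(1) unfolding append_take_drop_id by (simp add: cycle_list_def)
  have ne: "drop i ?L \<noteq> []" using assms(5) by simp
  have un: "set ?L = set (take i ?L) \<union> set (drop i ?L)" by (metis append_take_drop_id set_append)
  have len: "length p \<ge> 2"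
    using p assms(9) by (cases p rule: remdups_adj.cases) auto
  have "cycle_list (drop i ?L @ p)"
    unfolding cycle_list_def
  proof (intro conjI)
    have "last (drop i ?L) = z" using ne assms(5) by simp
    moreover have "set (drop i ?L) \<inter> set p = {}" using un c(2) pU by blast
    ultimately show "simple_path (drop i ?L @ p)"
      using L p(1,4) adj_sym[OF assms(2)] by (auto simp: simple_path_append)
    show "3 \<le> length (drop i ?L @ p)" using len assms(5) by simp
    have "hd (drop i ?L) = ?L ! i" using assms(5) by (intro hd_drop_conv_nth) simp
    moreover have "hd (drop i ?L @ p) = hd (drop i ?L)" using ne by (rule hd_append2)
    moreover have "last (drop i ?L @ p) = t" using p by simp
    ultimately show "adj (last (drop i ?L @ p)) (hd (drop i ?L @ p))" using adj by (simp only:)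
    show "set (drop i ?L @ p) \<subseteq> V" using un c(2) pU U_subset by auto
  qed
  moreover have "(set ?L - set (take i ?L)) \<union> set p = set (drop i ?L @ p)"
    using L un by (auto simp: simple_path_append)
  ultimately have "cycle_coverable ((set ?L - set (take i ?L)) \<union> set p)" using cycle_coverable_cycle by metis
  then have "cycle_remainder ((U - set p) \<union> set (take i ?L))"
    using remainder_swap[OF remainder_U c(2) c(3) pU] un by blast
  then have "cycle_remainder ((U - set p) \<union> set (take i (follow z)))" unfolding tk .
  moreover have "set (take i (follow z)) \<subseteq> V - U" using c(2) set_take_subset by fastforce
  moreover have "v \<in> set p" using p hd_in_set by blast
  ultimately show False using swap_drop_contra[of v "set p" "set (take i (follow z))"] pU p(6) assms(6,7)
    by blast
qed

text \<open>
  The central exchange.  The cycle stretches from \<open>follow z ! i\<close> to \<open>z\<close> and from \<open>follow z' ! j\<close> to \<open>z'\<close> are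
  joined at one end by the path \<open>p\<close> from \<open>v\<close> to \<open>v'\<close> and at the other end by a link \<open>xs\<close> through \<open>U\<close>.  The
  new cycle misses only the first \<open>i\<close> and the first \<open>j\<close> vertices.
\<close>

lemma remainder_of_link:
  assumes z: "z \<in> V - U" "z' \<in> V - U" "z \<noteq> z'" "adj v z" "adj v' z'"
    and p: "simple_path p" "p \<noteq> []" "set p \<subseteq> U" "hd p = v" "last p = v'"
    and ij: "i < length (follow z)" "j < length (follow z')"
      "\<And>A B. follow z = A @ z' # B \<Longrightarrow> follow z' = B @ z # A \<Longrightarrow> i < length A \<and> j < length B"
    and xs: "simple_path xs" "set xs \<subseteq> U" "set xs \<inter> set p = {}"
      "xs = [] \<or> adj (follow z ! i) (hd xs)" "adj (last (follow z ! i # xs)) (follow z' ! j)"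
  shows "cycle_remainder ((U - (set p \<union> set xs)) \<union> (set (take i (follow z)) \<union> set (take j (follow z'))))"
proof -
  note c = follow_cycle[OF z(1)] and c' = follow_cycle[OF z(2)]
  let ?R = "set (take i (follow z)) \<union> set (take j (follow z'))"
  show ?thesis
  proof (cases rule: follow_two[OF z(1-3), case_names same diff])
    case (diff)
    let ?P = "drop i (follow z) @ [z]" and ?Q = "drop j (follow z') @ [z']"
    let ?X = "set (follow z @ [z]) \<union> set (follow z' @ [z'])"
    have L: "simple_path (take i (follow z) @ ?P)" "simple_path (take j (follow z') @ ?Q)"
      using c(1) c'(1) unfolding append_assoc[symmetric] append_take_drop_id by (auto simp: cycle_list_def)
    have un: "set (follow z @ [z]) = set (take i (follow z)) \<union> set ?P"
      "set (follow z' @ [z']) = set (take j (follow z')) \<union> set ?Q"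
      by (metis append_assoc append_take_drop_id set_append)+
    have h: "hd ?P = follow z ! i" "hd ?Q = follow z' ! j"
      using ij by (auto simp: hd_append hd_drop_conv_nth)
    have "cycle_list (?P @ p @ rev ?Q @ rev xs)"
    proof (rule cycle_list_of_two_paths)
      show "simple_path ?P" "simple_path ?Q" using L simple_path_append by blast+
      show "set ?P \<inter> set ?Q = {}" using diff(1) un by blast
      show "set ?P \<inter> set p = {}" "set ?Q \<inter> set p = {}"
        using un c(2) c'(2) p(3) by blast+
      show "set xs \<inter> set ?P = {}" "set xs \<inter> set ?Q = {}"
        using un c(2) c'(2) xs(2) by blast+
      show "set ?P \<union> set ?Q \<union> set p \<union> set xs \<subseteq> V"
        using un c(2) c'(2) xs(2) p(3) U_subset by blast
      show "adj (last ?P) (hd p)" using adj_sym[OF z(4)] p(4) by simp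
      show "adj (last p) (last ?Q)" using z(5) p(5) by simp
      show "xs = [] \<or> adj (hd ?P) (hd xs)" "adj (last (hd ?P # xs)) (hd ?Q)"
        using xs(4,5) unfolding h by auto
    qed (use p xs in auto)
    moreover have "?X - ?R \<union> (set p \<union> set xs) = set (?P @ p @ rev ?Q @ rev xs)"
    proof -
      have "?X - ?R = set ?P \<union> set ?Q"
        using un diff(1) L unfolding simple_path_append by blast
      then show ?thesis by auto
    qed
    ultimately have "cycle_coverable (?X - ?R \<union> (set p \<union> set xs))" using cycle_coverable_cycle by metis
    then show ?thesis
      by (intro remainder_swap[OF remainder_U _ diff(2)]) (use c(2) c'(2) p xs un in blast)+
  next
    case (same A B)
    have lt: "i < length A" "j < length B" using ij(3)[OF same] by auto
    let ?P = "drop i A @ [z']" and ?Q = "drop j B @ [z]"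
    let ?X = "set (follow z @ [z])"
    have LX: "simple_path ((A @ [z']) @ B @ [z])" using c(1) same by (simp add: cycle_list_def)
    then have L: "simple_path (take i A @ ?P)" "simple_path (take j B @ ?Q)"
      unfolding append_assoc[symmetric] append_take_drop_id
      by (metis append_assoc simple_path_append)+
    have tk: "take i (follow z) = take i A" "take j (follow z') = take j B" using lt same by auto
    have X: "?X = set (take i A) \<union> set ?P \<union> (set (take j B) \<union> set ?Q)"
      "set (A @ [z']) = set (take i A) \<union> set ?P" "set (B @ [z]) = set (take j B) \<union> set ?Q"
      unfolding same by (metis append_assoc append_take_drop_id append_Cons append_Nil set_append)+
    have d: "(set (take i A) \<union> set ?P) \<inter> (set (take j B) \<union> set ?Q) = {}"
      using LX unfolding X(2,3)[symmetric] simple_path_append[of "A @ [z']"] by blast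
    have h: "hd ?P = follow z ! i" "hd ?Q = follow z' ! j"
      using lt same by (auto simp: hd_append hd_drop_conv_nth nth_append)
    \<comment> \<open>On a common cycle the stretch that starts in the arc \<open>A\<close> ends in \<open>z'\<close>, so \<open>p\<close> is traversed backwards.\<close>
    have "cycle_list (?P @ rev p @ rev ?Q @ rev xs)"
    proof (rule cycle_list_of_two_paths)
      show "simple_path ?P" "simple_path ?Q" using L simple_path_append by blast+
      show "set ?P \<inter> set ?Q = {}" using d by blast
      show "set ?P \<inter> set (rev p) = {}" "set ?Q \<inter> set (rev p) = {}"
        using X c(2) p(3) by auto
      show "set xs \<inter> set ?P = {}" "set xs \<inter> set ?Q = {}"
        using X(1) c(2) xs(2) by blast+
      show "set ?P \<union> set ?Q \<union> set (rev p) \<union> set xs \<subseteq> V"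
        using X(1) c(2) xs(2) p(3) U_subset by auto
      show "adj (last ?P) (hd (rev p))" using adj_sym[OF z(5)] p(2,5) by (simp add: hd_rev)
      show "adj (last (rev p)) (last ?Q)" using z(4) p(2,4) by (simp add: last_rev)
      show "xs = [] \<or> adj (hd ?P) (hd xs)" "adj (last (hd ?P # xs)) (hd ?Q)"
        using xs(4,5) unfolding h by auto
    qed (use p xs in auto)
    moreover have "?X - ?R \<union> (set p \<union> set xs) = set (?P @ rev p @ rev ?Q @ rev xs)"
    proof -
      have "?X - ?R = set ?P \<union> set ?Q"
        using X(1) d L unfolding tk simple_path_append by blast
      then show ?thesis by auto
    qed
    ultimately have "cycle_coverable (?X - ?R \<union> (set p \<union> set xs))" using cycle_coverable_cycle by metis
    then show ?thesis
      by (intro remainder_swap[OF remainder_U c(2,3)]) (use p xs X(1) tk in auto)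
  qed
qed

section \<open>The independent set obtained from the gains\<close>

text \<open>
  The walk along the cycle stops before the next neighbour of \<open>v\<close>, so that its vertices can be in an
  independent set with \<open>v\<close>.
\<close>

definition initial_run :: "'a \<Rightarrow> 'a \<Rightarrow> 'a list" where
  "initial_run v z = takeWhile (\<lambda>x. \<not> adj v x) (follow z)"

text \<open>
  Excludes the exchanges that take only \<open>v\<close> from its component and do not reconnect the rest of the
  component to the new vertices.  Optimality alone excludes the exchanges that also take the neighbour of \<open>v\<close>
  (\<open>swap_drop_contra\<close>), but not these: here \<open>alpha\<close> may stay the same.
\<close>

definition swap_free :: "'a \<Rightarrow> bool" where
  "swap_free v \<longleftrightarrow> (\<forall>Y R. Y \<subseteq> U \<longrightarrow> Y \<inter> component U v = {v} \<longrightarrow> R \<subseteq> V - U \<longrightarrow> detached (component U v) R \<longrightarrow>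
     alpha (U \<union> R) \<le> alpha U \<longrightarrow> \<not> cycle_remainder ((U - Y) \<union> R))"

definition absorbing :: "'a \<Rightarrow> 'a \<Rightarrow> bool" where
  "absorbing v z \<longleftrightarrow> alpha (U \<union> set (initial_run v z)) \<le> alpha U"

lemma initial_run_take: "take k (initial_run v z) = take (min k (length (initial_run v z))) (follow z)"
  unfolding initial_run_def by (metis min.commute take_take takeWhile_eq_take)

lemma initial_run_take_le: "k \<le> length (initial_run v z) \<Longrightarrow> take k (initial_run v z) = take k (follow z)"
  by (simp add: initial_run_take)

lemma initial_run_not_adj: "x \<in> set (initial_run v z) \<Longrightarrow> \<not> adj v x"
  unfolding initial_run_def by (auto dest: set_takeWhileD)

lemma length_initial_run: "length (initial_run v z) \<le> length (follow z)"
  unfolding initial_run_def by (rule length_takeWhile_le)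

lemma initial_run_detached:
  assumes v: "v \<in> U" "card (nbrs_in U v) \<le> 1" and z: "z \<in> V - U" "adj v z"
    and k: "k \<le> length (initial_run v z)" "\<And>i. i < k \<Longrightarrow> alpha (U \<union> set (take i (follow z))) \<le> alpha U"
  shows "detached (component U v) (set (take k (follow z)))"
  unfolding detached_def
proof (intro conjI ballI)
  have "set (take k (follow z)) \<subseteq> V - U" using follow_cycle(2)[OF z(1)] set_take_subset by fastforce
  then show "component U v \<inter> set (take k (follow z)) = {}" using component_subset by blast
next
  fix t r assume t: "t \<in> component U v" and r: "r \<in> set (take k (follow z))"
  obtain i where i: "i < k" "i < length (follow z)" "r = follow z ! i"
    using r by (auto simp: in_set_conv_nth)
  have na: "\<not> adj v x" if "x \<in> set (take k (follow z))" for x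
    using that initial_run_not_adj initial_run_take_le[OF k(1)] by (metis in_set_takeD)
  show "\<not> adj t r"
  proof (cases "t = v")
    case False
    have "\<not> adj t ((follow z @ [z]) ! i)"
    proof (rule component_closing[OF z v _ _ _ t False])
      show "\<not> adj v x" if "x \<in> set (take i (follow z))" for x
        using that na i(1) by (meson less_imp_le set_take_subset_set_take subsetD)
    qed (use i k in auto)
    then show ?thesis using i by (simp add: nth_append)
  qed (use na r in blast)
qed

lemma absorbing_take:
  assumes "absorbing v z" "i \<le> length (initial_run v z)"
  shows "alpha (U \<union> set (take i (follow z))) \<le> alpha U"
proof -
  have "set (take i (follow z)) \<subseteq> set (initial_run v z)"
    using initial_run_take_le[OF assms(2)] by (metis set_take_subset)
  then have "alpha (U \<union> set (take i (follow z))) \<le> alpha (U \<union> set (initial_run v z))"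
    by (intro alpha_mono) auto
  then show ?thesis using assms(1) by (simp add: absorbing_def)
qed

text \<open>
  If the walk from an absorbing \<open>z\<close> stopped at another neighbour \<open>y\<close> of \<open>v\<close>, then \<open>v\<close> and the stretch from
  \<open>y\<close> to \<open>z\<close> would form a cycle, and only the absorbed walk would be left over.  So the cycle of an absorbing
  neighbour contains no other neighbour of \<open>v\<close>.
\<close>

lemma absorbing_initial_run_eq:
  assumes v: "v \<in> U" "card (nbrs_in U v) \<le> 1" "swap_free v" and z: "z \<in> V - U" "adj v z"
    and ab: "absorbing v z"
  shows "initial_run v z = follow z"
proof (rule ccontr)
  assume "initial_run v z \<noteq> follow z"
  then obtain y ys where sp: "follow z = initial_run v z @ y # ys"
    unfolding initial_run_def by (metis append_self_conv takeWhile_dropWhile_id neq_Nil_conv)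
  have y: "adj v y"
    using sp unfolding initial_run_def
    by (metis dropWhile_eq_Cons_conv same_append_eq takeWhile_dropWhile_id)
  let ?n = "length (initial_run v z)"
  have tk: "take ?n (follow z) = initial_run v z" using sp by (metis append_eq_conv_conj)
  note c = follow_cycle[OF z(1)]
  let ?C = "(y # ys) @ [z] @ [v]"
  have vC: "v \<notin> set (follow z @ [z])" using c(2) v by blast
  have L: "simple_path (initial_run v z @ (y # ys @ [z]))" using c(1) sp by (simp add: cycle_list_def)
  have "cycle_list ?C"
  proof -
    have "simple_path (y # ys @ [z])" using L simple_path_append by blast
    then have "simple_path ((y # ys @ [z]) @ [v])"
      using vC adj_sym[OF z(2)] sp by (subst simple_path_append) auto
    then show ?thesis using y v c(2) sp U_subset by (auto simp: cycle_list_def)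
  qed
  moreover have "set (follow z @ [z]) - set (initial_run v z) \<union> {v} = set ?C"
    using L sp by (auto simp: simple_path_append)
  ultimately have "cycle_coverable (set (follow z @ [z]) - set (initial_run v z) \<union> {v})" using cycle_coverable_cycle by metis
  then have "cycle_remainder ((U - {v}) \<union> set (initial_run v z))"
    by (intro remainder_swap[OF remainder_U c(2,3)]) (use v sp in auto)
  moreover have "detached (component U v) (set (initial_run v z))"
    using initial_run_detached[OF v(1,2) z, of ?n] absorbing_take[OF ab] tk by simp
  moreover have "set (initial_run v z) \<subseteq> V - U" using c(2) sp by auto
  moreover have "{v} \<inter> component U v = {v}" using component_self[OF v(1)] by blast
  ultimately show False using v(1,3) ab unfolding swap_free_def absorbing_def by blast
qed

lemma initial_run_same_cycle:
  assumes "follow z = A @ z' # B" "adj v z'" shows "length (initial_run v z) \<le> length A"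
  using assms unfolding initial_run_def by (simp add: takeWhile_append length_takeWhile_le)

text \<open>
  Induction on the distances of the two linked vertices from \<open>z\<close> and \<open>z'\<close>: the vertices before them are
  unlinked, hence together they do not raise \<open>alpha\<close>, and a link would allow the exchange of
  \<open>remainder_of_link\<close> at no cost.
\<close>

lemma unlinked_if_no_swap:
  assumes z: "z \<in> V - U" "z' \<in> V - U" "z \<noteq> z'" "adj v z" "adj v' z'"
    and p: "simple_path p" "p \<noteq> []" "set p \<subseteq> component U v" "hd p = v" "last p = v'"
    and k: "k \<le> length (follow z)" "\<And>i. i < k \<Longrightarrow> alpha (U \<union> set (take i (follow z))) \<le> alpha U"
    and k': "k' \<le> length (follow z')" "\<And>i. i < k' \<Longrightarrow> alpha (U \<union> set (take i (follow z'))) \<le> alpha U"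
    and same_cycle: "\<And>A B. follow z = A @ z' # B \<Longrightarrow> follow z' = B @ z # A \<Longrightarrow> k \<le> length A \<and> k' \<le> length B"
    and det: "detached (component U v) (set (take k (follow z)))" "detached (component U v) (set (take k' (follow z')))"
    and no_swap: "\<And>X R. X \<subseteq> U - component U v \<Longrightarrow> R \<subseteq> V - U \<Longrightarrow> detached (component U v) R \<Longrightarrow>
        alpha (U \<union> R) \<le> alpha U \<Longrightarrow> \<not> cycle_remainder ((U - (set p \<union> X)) \<union> R)"
  shows "unlinked U (set (take k (follow z))) (set (take k' (follow z')))"
proof -
  have cells: "set (follow z) \<subseteq> V - U" "set (follow z') \<subseteq> V - U" using follow_cycle(2) z by auto
  have main: "\<not> linked U (follow z ! i) (follow z' ! j)" if "i < k" "j < k'" for i j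
    using that
  proof (induction "i + j" arbitrary: i j rule: less_induct)
    case less
    let ?A = "set (take i (follow z))" and ?B = "set (take j (follow z'))"
    have il: "i < length (follow z)" "j < length (follow z')" using less.prems k(1) k'(1) by linarith+
    have sc: "i < length A \<and> j < length B" if "follow z = A @ z' # B" "follow z' = B @ z # A" for A B
      using same_cycle[OF that] less.prems by linarith
    have "unlinked U ?A ?B"
      unfolding unlinked_def
    proof (intro ballI)
      fix r s assume "r \<in> ?A" "s \<in> ?B"
      then obtain i' j' where "i' < i" "r = follow z ! i'" "j' < j" "s = follow z' ! j'"
        by (auto simp: in_set_conv_nth)
      then show "\<not> linked U r s" using less.hyps[of i' j'] less.prems by simp
    qed
    then have "alpha (U \<union> ?A \<union> ?B) + alpha U = alpha (U \<union> ?A) + alpha (U \<union> ?B)"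
      by (rule unlinked_alpha) (use cells set_take_subset in fastforce)+
    then have al: "alpha (U \<union> (?A \<union> ?B)) \<le> alpha U"
      using k(2)[OF less.prems(1)] k'(2)[OF less.prems(2)] by (simp add: Un_assoc)
    show ?case
    proof
      assume lk: "linked U (follow z ! i) (follow z' ! j)"
      have ne: "follow z ! i \<noteq> follow z' ! j"
      proof (cases rule: follow_two[OF z(1-3), case_names same diff])
        case (same A B)
        then have "i < length A" "j < length B" using sc[OF same] by auto
        then have "follow z ! i \<in> set A" "follow z' ! j \<in> set B" using same by (auto simp: nth_append)
        moreover have "distinct (follow z)" using follow_cycle(1)[OF z(1)] by (simp add: cycle_list_def simple_path_def)
        ultimately show ?thesis using same by auto
      next
        case diff
        then show ?thesis using il by (auto dest!: nth_mem)
      qed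
      obtain xs where xs: "simple_path xs" "set xs \<subseteq> U" "xs = [] \<or> adj (follow z ! i) (hd xs)"
        "adj (last (follow z ! i # xs)) (follow z' ! j)"
      proof (cases "adj (follow z ! i) (follow z' ! j)")
        case True
        then show ?thesis using that[of "[]"] by simp
      next
        case False
        then show ?thesis using lk ne that unfolding linked_def by auto
      qed
      have ri: "follow z ! i \<in> set (take k (follow z))"
        using less.prems il by (auto simp: in_set_conv_nth intro!: exI[of _ i])
      \<comment> \<open>A link through the component of \<open>v\<close> would make that component adjacent to the walk.\<close>
      have xsT: "set xs \<inter> component U v = {}"
      proof (rule ccontr)
        assume ne: "set xs \<inter> component U v \<noteq> {}"
        then have "set xs \<subseteq> component U v"
          by (rule simple_path_in_closed[OF xs(1,2)]) (rule component_closed)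
        moreover have "xs \<noteq> []" using ne by auto
        ultimately have "hd xs \<in> component U v" "adj (hd xs) (follow z ! i)" using xs(3) hd_in_set adj_sym by blast+
        then show False using det(1) ri by (auto simp: detached_def)
      qed
      have "cycle_remainder ((U - (set p \<union> set xs)) \<union> (?A \<union> ?B))"
      proof (rule remainder_of_link[OF z p(1,2) _ p(4,5)])
        show "set p \<subseteq> U" using p(3) component_subset by blast
        show "set xs \<inter> set p = {}" using xsT p(3) by blast
      qed (use il xs sc in auto)
      moreover have "detached (component U v) (?A \<union> ?B)"
        using det less.prems set_take_subset_set_take[of i k "follow z"] set_take_subset_set_take[of j k' "follow z'"]
        unfolding detached_def by fastforce
      moreover have "set xs \<subseteq> U - component U v" using xsT xs by auto
      moreover have "?A \<union> ?B \<subseteq> V - U" using cells by (meson Un_least set_take_subset subset_trans)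
      ultimately show False using no_swap al by blast
    qed
  qed
  show ?thesis unfolding unlinked_def using main by (fastforce simp: in_set_conv_nth)
qed

lemma unlinked_initial_runs:
  assumes v: "v \<in> U" "card (nbrs_in U v) \<le> 1" "swap_free v"
    and z: "z \<in> V - U" "adj v z" "z' \<in> V - U" "adj v z'" "z \<noteq> z'"
    and k: "k \<le> length (initial_run v z)" "\<And>i. i < k \<Longrightarrow> alpha (U \<union> set (take i (follow z))) \<le> alpha U"
    and k': "k' \<le> length (initial_run v z')" "\<And>i. i < k' \<Longrightarrow> alpha (U \<union> set (take i (follow z'))) \<le> alpha U"
  shows "unlinked U (set (take k (follow z))) (set (take k' (follow z')))"
proof (rule unlinked_if_no_swap[OF z(1,3,5,2,4), of "[v]"])
  show "k \<le> length (follow z)" "k' \<le> length (follow z')"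
    using k(1) k'(1) length_initial_run[of v z] length_initial_run[of v z'] by linarith+
  show "k \<le> length A \<and> k' \<le> length B" if "follow z = A @ z' # B" "follow z' = B @ z # A" for A B
    using initial_run_same_cycle[OF that(1) z(4)] initial_run_same_cycle[OF that(2) z(2)] k(1) k'(1) by linarith
  show "detached (component U v) (set (take k (follow z)))" "detached (component U v) (set (take k' (follow z')))"
    using initial_run_detached[OF v(1,2)] z k k' by auto
  show "\<not> cycle_remainder ((U - (set [v] \<union> X)) \<union> R)"
    if "X \<subseteq> U - component U v" "R \<subseteq> V - U" "detached (component U v) R" "alpha (U \<union> R) \<le> alpha U" for X R
  proof -
    have "(set [v] \<union> X) \<inter> component U v = {v}" "set [v] \<union> X \<subseteq> U"
      using that(1) component_self[OF v(1)] v(1) by auto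
    then show ?thesis using v(3) that unfolding swap_free_def by blast
  qed
qed (use k k' component_self[OF v(1)] in auto)

text \<open>
  Each neighbour in \<open>F\<close> contributes the shortest prefix of its walk that raises \<open>alpha\<close>.  The prefixes are
  pairwise unlinked, so the gains add up, and in a maximum independent set \<open>v\<close> can replace its
  neighbour in \<open>U\<close>, should it have one.
\<close>

lemma independent_set_from_gains:
  assumes v: "v \<in> U" "card (nbrs_in U v) \<le> 1" "swap_free v"
    and F: "F \<subseteq> {z \<in> V - U. adj v z \<and> \<not> absorbing v z}"
  shows "\<exists>I. indep I \<and> I \<subseteq> V \<and> v \<in> I \<and> alpha U + card F \<le> card I"
proof -
  define k where "k z = (LEAST k. alpha U < alpha (U \<union> set (take k (initial_run v z))))" for z
  have F1: "z \<in> V - U" "adj v z" "\<not> absorbing v z" if "z \<in> F" for z using F that by auto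
  have k0: "alpha U < alpha (U \<union> set (take (k z) (initial_run v z))) \<and> k z \<le> length (initial_run v z)" if "z \<in> F" for z
  proof -
    have w: "alpha U < alpha (U \<union> set (take (length (initial_run v z)) (initial_run v z)))"
      using F1(3)[OF that] by (simp add: absorbing_def)
    show ?thesis unfolding k_def
      using LeastI[of "\<lambda>k. alpha U < alpha (U \<union> set (take k (initial_run v z)))", OF w]
        Least_le[of "\<lambda>k. alpha U < alpha (U \<union> set (take k (initial_run v z)))", OF w] by blast
  qed
  define S where "S z = set (take (k z) (follow z))" for z
  have S: "S z = set (take (k z) (initial_run v z))" if "z \<in> F" for z
    using k0[OF that] by (simp add: S_def initial_run_take_le)
  have kmin: "alpha (U \<union> set (take i (follow z))) \<le> alpha U" if "z \<in> F" "i < k z" for z i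
  proof -
    have "\<not> alpha U < alpha (U \<union> set (take i (initial_run v z)))"
      using not_less_Least that(2) unfolding k_def by blast
    then show ?thesis using that k0[OF that(1)] by (simp add: initial_run_take_le)
  qed
  have SV: "S z \<subseteq> V - U" if "z \<in> F" for z
    using follow_cycle(2)[OF F1(1)[OF that]] set_take_subset[of "k z" "follow z"] by (auto simp: S_def)
  have fin: "finite F" by (rule finite_subset[OF F]) (simp add: finite_V)
  have big: "alpha U + card F \<le> alpha (U \<union> (\<Union>z\<in>F. S z))"
  proof (rule unlinked_family_alpha[OF fin])
    show "S z \<inter> U = {}" if "z \<in> F" for z using SV[OF that] by blast
    show "alpha U + 1 \<le> alpha (U \<union> S z)" if "z \<in> F" for z using k0[OF that] S[OF that] by simp
    show "unlinked U (S z) (S z')" if "z \<in> F" "z' \<in> F" "z \<noteq> z'" for z z'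
      unfolding S_def
      by (rule unlinked_initial_runs[OF v F1(1,2)[OF that(1)] F1(1,2)[OF that(2)] that(3)])
        (use that k0 kmin in auto)
  qed
  obtain K where K: "K \<subseteq> U \<union> (\<Union>z\<in>F. S z)" "K \<subseteq> V" "finite K" "indep K"
    "card K = alpha (U \<union> (\<Union>z\<in>F. S z))" by (rule alpha_witness)
  have nbK: "x \<in> nbrs_in U v" if "x \<in> K" "adj v x" for x
  proof -
    have "x \<notin> S z" if "z \<in> F" for z
      using S[OF that] \<open>adj v x\<close> initial_run_not_adj in_set_takeD by metis
    then show ?thesis using K(1) that by (auto simp: nbrs_in_def)
  qed
  let ?I = "insert v (K - nbrs_in U v)"
  have "indep ?I"
    using K(4) nbK adj_irrefl adj_sym unfolding indep_def by blast
  moreover have "?I \<subseteq> V" using K(2) v U_subset by auto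
  moreover have "card K \<le> card ?I"
  proof (cases "v \<in> K")
    case True
    then have "nbrs_in U v \<inter> K = {}" using K(4) by (auto simp: indep_def nbrs_in_def)
    then have "?I = K" using True by auto
    then show ?thesis by simp
  next
    case False
    have f: "finite (nbrs_in U v)" using finite_U by (simp add: nbrs_in_def)
    have "card K - card (nbrs_in U v) \<le> card (K - nbrs_in U v)" by (rule diff_card_le_card_Diff[OF f])
    then show ?thesis using False K(3) v(2) by simp
  qed
  ultimately show ?thesis using big K(5) by (intro exI[of _ ?I]) auto
qed

section \<open>Criteria for exchanges\<close>

lemma alpha_component_split: "alpha U = alpha (component U v) + alpha (U - component U v)"
  using alpha_Un_detached[OF detached_component[of U v]] component_subset[of U v] by (simp add: Un_absorb1)

lemma alpha_component_critical:
  assumes "v \<in> U" "alpha (U - {v}) < alpha U"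
  shows "alpha (component U v - {v}) < alpha (component U v)"
proof -
  let ?T = "component U v"
  have "detached (?T - {v}) (U - ?T)" by (rule detached_mono[OF detached_component]) auto
  then have "alpha ((?T - {v}) \<union> (U - ?T)) = alpha (?T - {v}) + alpha (U - ?T)"
    by (rule alpha_Un_detached)
  moreover have "(?T - {v}) \<union> (U - ?T) = U - {v}" using component_subset component_self[OF assms(1)] by blast
  ultimately show ?thesis using assms(2) alpha_component_split[of v] by simp
qed

lemma alpha_Un_component:
  assumes "R \<inter> U = {}" "detached (component U v) R"
  shows "alpha (U \<union> R) = alpha (component U v) + alpha ((U - component U v) \<union> R)"
proof -
  let ?T = "component U v"
  have "detached ?T ((U - ?T) \<union> R)" by (rule detached_Un_right[OF detached_component assms(2)])
  moreover have "?T \<union> ((U - ?T) \<union> R) = U \<union> R" using component_subset by blast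
  ultimately show ?thesis using alpha_Un_detached by metis
qed

text \<open>
  The loss of \<open>v\<close> costs its component one unit of \<open>alpha\<close>, and the rest together with \<open>R\<close> cannot make
  up for it.
\<close>

lemma critical_no_swap:
  assumes v: "v \<in> U" "alpha (U - {v}) < alpha U" and "v \<in> Y" "R \<subseteq> V - U" "detached (component U v) R"
    "alpha (U \<union> R) \<le> alpha U"
  shows "\<not> cycle_remainder ((U - Y) \<union> R)"
proof
  let ?T = "component U v"
  assume "cycle_remainder ((U - Y) \<union> R)"
  then have "alpha U \<le> alpha ((U - Y) \<union> R)" by (rule optimal_alpha_le[OF optimal_U])
  also have "\<dots> \<le> alpha ((?T - {v}) \<union> ((U - ?T) \<union> R))" using assms(3) by (intro alpha_mono) auto
  also have "\<dots> \<le> alpha (?T - {v}) + alpha ((U - ?T) \<union> R)" by (rule alpha_Un_le)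
  also have "\<dots> < alpha ?T + alpha ((U - ?T) \<union> R)" using alpha_component_critical[OF v] by simp
  also have "\<dots> = alpha (U \<union> R)" using assms(4,5) by (intro alpha_Un_component[symmetric]) auto
  finally show False using assms(6) by simp
qed

lemma swap_free_critical: "v \<in> U \<Longrightarrow> alpha (U - {v}) < alpha U \<Longrightarrow> swap_free v"
  unfolding swap_free_def using critical_no_swap by blast

text \<open>
  One unit may be lost: either at an absorbing neighbour or at the neighbour in \<open>U\<close>.
\<close>

lemma good_vertex:
  assumes v: "v \<in> U" "swap_free v"
    and le: "card (nbrs_in U v) + card {z \<in> V - U. adj v z \<and> absorbing v z} \<le> 1"
  shows "\<exists>I. indep I \<and> I \<subseteq> V \<and> v \<in> I \<and> alpha U + card (nbrs_in V v) \<le> card I + 1"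
proof -
  let ?F = "{z \<in> V - U. adj v z \<and> \<not> absorbing v z}"
  let ?B = "{z \<in> V - U. adj v z \<and> absorbing v z}"
  obtain I where I: "indep I" "I \<subseteq> V" "v \<in> I" "alpha U + card ?F \<le> card I"
    using independent_set_from_gains[of v ?F] v le by auto
  have "nbrs_in V v = nbrs_in U v \<union> ?B \<union> ?F" using U_subset by (auto simp: nbrs_in_def)
  then have "card (nbrs_in V v) \<le> card (nbrs_in U v) + card ?B + card ?F"
    by (metis (no_types, lifting) add_le_mono1 card_Un_le order_trans)
  then show ?thesis using I le by (intro exI[of _ I]) auto
qed

section \<open>All optimal remainders are balanced\<close>

text \<open>
  Both parts satisfy the inequality \<open>tight_card_le\<close>, so equality for the union forces equality for the
  parts.
\<close>

lemma part_card_eq: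
  assumes "tight (P \<union> Q)" "detached P Q" "P \<union> Q \<subseteq> V" "card (P \<union> Q) = 2 * alpha (P \<union> Q)"
  shows "card P = 2 * alpha P"
proof -
  have fin: "finite P" "finite Q" using assms(3) finite_V finite_subset by auto
  have "detached Q P" using assms(2) detached_commute by blast
  then have "tight P" "tight Q"
    using tight_detached[OF assms(1,2)] tight_detached[of Q P] assms(1) by (simp_all add: Un_commute)
  then have "card P \<le> 2 * alpha P" "card Q \<le> 2 * alpha Q"
    using assms(3) by (simp_all add: tight_card_le)
  moreover have "card (P \<union> Q) = card P + card Q" using fin assms(2)
    by (intro card_Un_disjoint) (auto simp: detached_def)
  moreover have "alpha (P \<union> Q) = alpha P + alpha Q" by (rule alpha_Un_detached[OF assms(2)])
  ultimately show ?thesis using assms(4) by linarith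
qed

text \<open>
  Parity: the component of \<open>v\<close> has an even number of vertices, and so has what the exchange leaves of it,
  which is the component without \<open>v\<close>.
\<close>

lemma swap_free_balanced:
  assumes bal: "\<And>W. optimal W \<Longrightarrow> card W = 2 * alpha W" and v: "v \<in> U"
  shows "swap_free v"
  unfolding swap_free_def
proof (intro allI impI notI)
  fix Y R assume h: "Y \<subseteq> U" "Y \<inter> component U v = {v}" "R \<subseteq> V - U" "detached (component U v) R"
    "alpha (U \<union> R) \<le> alpha U" "cycle_remainder ((U - Y) \<union> R)"
  let ?T = "component U v" and ?W = "(U - Y) \<union> R"
  let ?O = "?W - (?T - {v})"
  have TU: "?T \<subseteq> U" "v \<in> ?T" using component_subset component_self[OF v] by auto
  have "alpha ?W \<le> alpha (U \<union> R)" by (rule alpha_mono) auto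
  then have W: "optimal ?W" using optimalI[OF optimal_U h(6)] h(5) by simp
  have e: "(?T - {v}) \<union> ?O = ?W" using TU h(2) by blast
  have O: "?O \<subseteq> (U - ?T) \<union> R" by (use h(2) in \<open>auto\<close>)
  have "detached ?T ((U - ?T) \<union> R)" by (rule detached_Un_right[OF detached_component h(4)])
  then have d: "detached (?T - {v}) ?O" by (rule detached_mono[OF _ Diff_subset O])
  have "?W \<subseteq> V" using U_subset h(3) by blast
  then have "card (?T - {v}) = 2 * alpha (?T - {v})"
    using part_card_eq[OF _ d] optimal_tight[OF W] bal[OF W] unfolding e by blast
  moreover have "?T \<union> (U - ?T) = U" using TU by blast
  then have "card ?T = 2 * alpha ?T"
    using part_card_eq[OF _ detached_component[of U v]] tight_U bal[OF optimal_U] U_subset by simp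
  moreover have "card ?T = Suc (card (?T - {v}))"
    using TU finite_U by (metis card.remove finite_subset)
  ultimately have "Suc (2 * alpha (?T - {v})) = 2 * alpha ?T" by simp
  then show False by presburger
qed

text \<open>
  If the cycle without \<open>z\<close> were absorbed, then \<open>U\<close> together with it would have too many vertices for its
  independence number.  So it contains cycles whose removal pays; with these cycles in the cover, the
  vertex \<open>z\<close> can be returned to the remainder, which is then optimal, hence of size \<open>2 * alpha U\<close>, and again
  has too many vertices when \<open>z\<close> is taken out.
\<close>

lemma balanced_not_absorbed:
  assumes bal: "\<And>W. optimal W \<Longrightarrow> card W = 2 * alpha W" and z: "z \<in> V - U"
  shows "alpha U < alpha (U \<union> set (follow z))"
proof (rule ccontr)
  assume "\<not> ?thesis"
  then have le: "alpha (U \<union> set (follow z)) \<le> alpha U" by simp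
  let ?W = "U \<union> set (follow z)"
  note c = follow_cycle[OF z]
  have WV: "?W \<subseteq> V" using U_subset c(2) by auto
  \<comment> \<open>\<open>Z\<close> collects the cycles whose removal pays; what is left is tight.\<close>
  have "\<exists>Z. (cycle_coverable Z \<and> Z \<subseteq> ?W) \<and> (\<forall>Z'. cycle_coverable Z' \<and> Z' \<subseteq> ?W \<longrightarrow> alpha (?W - Z) \<le> alpha (?W - Z'))"
    by (rule ex_has_least_nat[where k="{}"]) (simp add: cycle_coverable_empty)
  then obtain Z where Z: "cycle_coverable Z" "Z \<subseteq> ?W"
    and mn: "\<And>Z'. cycle_coverable Z' \<Longrightarrow> Z' \<subseteq> ?W \<Longrightarrow> alpha (?W - Z) \<le> alpha (?W - Z')" by blast
  let ?W2 = "?W - Z"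
  have "tight ?W2"
    unfolding tight_def
  proof (intro allI impI)
    fix xs assume xs: "cycle_list xs" "set xs \<subseteq> ?W2"
    have "cycle_coverable (Z \<union> set xs)" by (rule cycle_coverable_union[OF Z(1) cycle_coverable_cycle[OF xs(1)]]) (use xs in blast)
    moreover have "Z \<union> set xs \<subseteq> ?W" using Z xs by blast
    moreover have "?W - (Z \<union> set xs) = ?W2 - set xs" by blast
    ultimately show "alpha ?W2 \<le> alpha (?W2 - set xs)" using mn by metis
  qed
  then have c2: "card ?W2 \<le> 2 * alpha ?W2" using WV by (intro tight_card_le) auto
  have zW: "z \<notin> ?W" using z c(1) by (auto simp: cycle_list_def simple_path_append)
  have "V - (?W2 \<union> {z}) = (V - U - set (follow z @ [z])) \<union> Z" using Z zW WV by auto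
  moreover have "cycle_coverable ((V - U - set (follow z @ [z])) \<union> Z)"
    by (rule cycle_coverable_union[OF c(3) Z(1)]) (use Z in auto)
  ultimately have r: "cycle_remainder (?W2 \<union> {z})" using WV z by (auto simp: cycle_remainder_def)
  have a1: "alpha (?W2 \<union> {z}) \<le> alpha ?W2 + 1"
    using alpha_Un_le[of ?W2 "{z}"] alpha_singleton z by simp
  have a2: "alpha U \<le> alpha (?W2 \<union> {z})" by (rule optimal_alpha_le[OF optimal_U r])
  have a3: "alpha ?W2 \<le> alpha U" using alpha_mono[of ?W2 ?W] le by simp
  show False
  proof (cases "alpha ?W2 = alpha U")
    case True
    have "tight ?W"
      unfolding tight_def
    proof (intro allI impI)
      fix xs assume xs: "cycle_list xs" "set xs \<subseteq> ?W"
      show "alpha ?W \<le> alpha (?W - set xs)" using mn[OF cycle_coverable_cycle[OF xs(1)] xs(2)] True le by simp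
    qed
    then have "card ?W \<le> 2 * alpha ?W" using WV by (rule tight_card_le)
    also have "\<dots> \<le> card U" using le bal[OF optimal_U] by simp
    finally have "card ?W \<le> card U" .
    moreover have "card ?W = card U + card (set (follow z))"
      using finite_U c(2) by (intro card_Un_disjoint) auto
    moreover have "card (set (follow z)) \<ge> 2"
      using c(1) by (simp add: cycle_list_def simple_path_append distinct_card simple_path_distinct)
    ultimately show False by simp
  next
    case False
    then have "alpha (?W2 \<union> {z}) \<le> alpha U" using a1 a3 by simp
    then have "optimal (?W2 \<union> {z})" "alpha (?W2 \<union> {z}) = alpha U" using optimalI[OF optimal_U r] by auto
    then have "card (?W2 \<union> {z}) = 2 * alpha U" using bal by metis
    moreover have "card (?W2 \<union> {z}) \<le> card ?W2 + 1"
      using card_Un_le[of ?W2 "{z}"] by simp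
    ultimately show False using c2 a3 False by linarith
  qed
qed

lemma balanced_case:
  assumes bal: "\<And>W. optimal W \<Longrightarrow> card W = 2 * alpha W" and "U \<noteq> {}"
  shows "\<exists>v I. indep I \<and> I \<subseteq> V \<and> v \<in> I \<and> alpha U + card (nbrs_in V v) \<le> card I + 1"
proof -
  obtain v0 where "v0 \<in> U" using assms(2) by blast
  show ?thesis
  proof (cases rule: tight_has_leaf[OF tight_U U_subset \<open>v0 \<in> U\<close>, case_names isolated leaf])
    case (isolated v)
    have a: "alpha (U - {v}) + 1 \<le> alpha U"
      using isolated U_subset by (intro alpha_diff_closed_nbhd[of v]) auto
    have "alpha {v} \<le> 1" by (rule alpha_clique) auto
    then have "tight (U - {v})" by (rule tight_diff_clique[OF tight_U a])
    then have "card (U - {v}) \<le> 2 * alpha (U - {v})" using U_subset by (intro tight_card_le) auto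
    moreover have "card U = Suc (card (U - {v}))" using isolated finite_U by (metis card.remove)
    ultimately have False using a bal[OF optimal_U] by linarith
    then show ?thesis ..
  next
    case (leaf v p)
    have sp: "swap_free v" by (rule swap_free_balanced[OF bal leaf(1)])
    have n: "card (nbrs_in U v) \<le> 1" using leaf(5) by simp
    have "\<not> absorbing v z" if "z \<in> V - U" "adj v z" for z
    proof
      assume "absorbing v z"
      then have "alpha (U \<union> set (follow z)) \<le> alpha U"
        using absorbing_initial_run_eq[OF leaf(1) n sp that] by (simp add: absorbing_def)
      then show False using balanced_not_absorbed[OF bal that(1)] by simp
    qed
    then have "{z \<in> V - U. adj v z \<and> absorbing v z} = {}" by blast
    then have "card (nbrs_in U v) + card {z \<in> V - U. adj v z \<and> absorbing v z} \<le> 1"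
      using n by (simp only: card.empty)
    then show ?thesis using good_vertex[OF leaf(1) sp] by blast
  qed
qed

section \<open>A largest unbalanced optimal remainder\<close>

definition critical :: "'a \<Rightarrow> bool" where
  "critical v \<longleftrightarrow> v \<in> U \<and> alpha (U - {v}) < alpha U \<and> card (nbrs_in U v) \<le> 1"

context
  assumes unbalanced: "card U \<noteq> 2 * alpha U"
    and largest: "\<And>W. optimal W \<Longrightarrow> card W \<noteq> 2 * alpha W \<Longrightarrow> card W \<le> card U"
begin

text \<open>
  The cycle of an absorbing neighbour \<open>z\<close> of a critical vertex \<open>v\<close> hangs on the component of \<open>v\<close> by the
  edge between \<open>v\<close> and \<open>z\<close> alone.  Adding the whole cycle to \<open>U\<close> does not raise \<open>alpha\<close>: the edge takes the
  place of the critical vertex.  This remainder is optimal and larger than \<open>U\<close>, so it has exactly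
  \<open>2 * alpha U\<close> vertices.
\<close>

lemma absorbing_critical:
  assumes v: "critical v" and z: "z \<in> V - U" "adj v z" "absorbing v z"
  shows "alpha (U \<union> set (follow z)) \<le> alpha U"
    and "detached (component U v) (set (follow z))"
    and "\<And>t. t \<in> component U v \<Longrightarrow> t \<noteq> v \<Longrightarrow> \<not> adj t z"
    and "card U + card (set (follow z)) + 1 = 2 * alpha U"
    and "tight (U \<union> set (follow z))"
proof -
  let ?T = "component U v" and ?A = "set (follow z)"
  note c = follow_cycle[OF z(1)]
  have v': "v \<in> U" "alpha (U - {v}) < alpha U" "card (nbrs_in U v) \<le> 1" using v by (auto simp: critical_def)
  have TU: "?T \<subseteq> U" "v \<in> ?T" using component_subset component_self[OF v'(1)] by auto
  have run: "initial_run v z = follow z"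
    by (rule absorbing_initial_run_eq[OF v'(1,3) swap_free_critical[OF v'(1,2)] z])
  show le: "alpha (U \<union> ?A) \<le> alpha U" using z(3) run by (simp add: absorbing_def)
  show det: "detached ?T ?A"
    using initial_run_detached[OF v'(1,3) z(1,2), of "length (follow z)"] absorbing_take[OF z(3)] run by simp
  show "\<not> adj t z" if "t \<in> ?T" "t \<noteq> v" for t
    using component_closing[OF z(1,2) v'(1,3) le_refl _ _ that] le initial_run_not_adj[of _ v z] run by simp
  have AU: "?A \<inter> U = {}" "z \<notin> ?A" using c(1,2) by (auto simp: cycle_list_def simple_path_append)
  let ?C = "U \<union> set (follow z @ [z])"
  have crit: "alpha (?T - {v}) + 1 \<le> alpha ?T" using alpha_component_critical[OF v'(1,2)] by simp
  \<comment> \<open>The set \<open>S\<close> is empty for the optimality of \<open>?C\<close> and a cycle for the tightness.\<close>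
  have bound: "alpha (?C - S) \<le> alpha ?T + alpha (((U - ?T) \<union> ?A) - S)" for S
  proof -
    have "alpha (?C - S) \<le> alpha (((?T - {v}) \<union> {v, z}) \<union> (((U - ?T) \<union> ?A) - S))"
      by (rule alpha_mono) auto
    also have "\<dots> \<le> alpha (?T - {v}) + alpha {v, z} + alpha (((U - ?T) \<union> ?A) - S)"
      by (meson add_mono alpha_Un_le order_refl order_trans)
    finally show ?thesis using alpha_edge[OF z(2)] crit by linarith
  qed
  have aUA: "alpha (U \<union> ?A) = alpha ?T + alpha ((U - ?T) \<union> ?A)"
    by (rule alpha_Un_component[OF AU(1) det])
  have "V - ?C = V - U - set (follow z @ [z])" by blast
  then have "cycle_remainder ?C" using c(2,3) U_subset by (auto simp: cycle_remainder_def)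
  moreover have "alpha ?C \<le> alpha U" using bound[of "{}"] aUA le by simp
  ultimately have C: "optimal ?C" "alpha ?C = alpha U" using optimalI[OF optimal_U] by auto
  have cardC: "card ?C = card U + card ?A + 1"
  proof -
    have "?C = insert z (U \<union> ?A)" by auto
    moreover have "card (U \<union> ?A) = card U + card ?A" using finite_U AU by (intro card_Un_disjoint) auto
    ultimately show ?thesis using z(1) AU(2) finite_U by simp
  qed
  then show "card U + card ?A + 1 = 2 * alpha U" using largest[OF C(1)] C(2) by fastforce
  show "tight (U \<union> ?A)"
    unfolding tight_def
  proof (intro allI impI)
    fix xs assume xs: "cycle_list xs" "set xs \<subseteq> U \<union> ?A"
    show "alpha (U \<union> ?A) \<le> alpha (U \<union> ?A - set xs)"
    \<comment> \<open>A cycle does not use the edge between \<open>v\<close> and \<open>z\<close>: it lies inside the component of \<open>v\<close> or avoids it.\<close>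
    proof (cases "set xs \<inter> ?T = {}")
      case False
      have "set xs \<subseteq> ?T"
      proof (rule simple_path_in_closed[OF _ xs(2) False])
        show "simple_path xs" using xs(1) by (simp add: cycle_list_def)
        show "y \<in> ?T" if "x \<in> ?T" "y \<in> U \<union> ?A" "adj x y" for x y
          using that det component_closed[of x U v y] by (auto simp: detached_def)
      qed
      then have "set xs \<subseteq> U" using TU by blast
      then have "alpha U \<le> alpha (U - set xs)" using tight_U xs(1) by (auto simp: tight_def)
      also have "\<dots> \<le> alpha (U \<union> ?A - set xs)" by (rule alpha_mono) auto
      finally show ?thesis using le by simp
    next
      case True
      have "alpha U \<le> alpha (?C - set xs)"
        using optimal_tight[OF C(1)] xs C(2) unfolding tight_def by fastforce
      also have "\<dots> \<le> alpha ?T + alpha (((U - ?T) \<union> ?A) - set xs)" by (rule bound)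
      also have "\<dots> = alpha (?T \<union> (((U - ?T) \<union> ?A) - set xs))"
      proof (rule alpha_Un_detached[symmetric])
        show "detached ?T (((U - ?T) \<union> ?A) - set xs)"
          using det detached_component[of U v] by (auto simp: detached_def)
      qed
      also have "\<dots> \<le> alpha (U \<union> ?A - set xs)" using TU True by (intro alpha_mono) blast
      finally show ?thesis using le by simp
    qed
  qed
qed

text \<open>
  Two cycles absorbed at the same component are not linked, for otherwise a path in the component would
  close an exchange that costs a critical vertex.  So they are absorbed by two disjoint parts of \<open>U\<close>, and the
  size bound \<open>tight_card_le\<close> for both parts leaves no room for the second cycle.
\<close>

lemma absorbing_critical_unique:
  assumes v: "critical v" "critical v'" "v' \<in> component U v"
    and z: "z \<in> V - U" "adj v z" "absorbing v z" and z': "z' \<in> V - U" "adj v' z'" "absorbing v' z'"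
  shows "z = z'"
proof (rule ccontr)
  assume ne: "z \<noteq> z'"
  let ?A = "set (follow z)" and ?B = "set (follow z')"
  note a = absorbing_critical[OF v(1) z] and b = absorbing_critical[OF v(2) z']
  have component: "component U v' = component U v" by (rule component_eq[OF v(3)])
  have vU: "v \<in> U" "alpha (U - {v}) < alpha U" "card (nbrs_in U v) \<le> 1"
    using v(1) by (auto simp: critical_def)
  obtain p where p: "simple_path p" "p \<noteq> []" "set p \<subseteq> component U v" "hd p = v" "last p = v'"
    using component_path[OF v(3) vU(3)] by metis
  have vp: "v \<in> set p" using p(2,4) hd_in_set by blast
  have zA: "z' \<notin> ?A" using a(2) v(3) z'(2) by (auto simp: detached_def)
  have sub: "?A \<subseteq> V - U" "?B \<subseteq> V - U" using follow_cycle(2) z z' by auto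
  have mono: "alpha (U \<union> set (take i (follow x))) \<le> alpha (U \<union> set (follow x))" for i x
    by (rule alpha_mono) (use set_take_subset in fastforce)
  have "unlinked U (set (take (length (follow z)) (follow z))) (set (take (length (follow z')) (follow z')))"
  proof (rule unlinked_if_no_swap[OF z(1) z'(1) ne z(2) z'(2) p])
    show "alpha (U \<union> set (take i (follow z))) \<le> alpha U" for i using mono a(1) order_trans by blast
    show "alpha (U \<union> set (take i (follow z'))) \<le> alpha U" for i using mono b(1) order_trans by blast
    show "detached (component U v) (set (take (length (follow z)) (follow z)))" using a(2) by simp
    show "detached (component U v) (set (take (length (follow z')) (follow z')))" using b(2) component by simp
    show "\<not> cycle_remainder ((U - (set p \<union> X)) \<union> R)"
      if "R \<subseteq> V - U" "detached (component U v) R" "alpha (U \<union> R) \<le> alpha U" for X R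
      using critical_no_swap[OF vU(1,2) _ that] vp by blast
  qed (use zA in auto)
  then have "unlinked U ?A ?B" by simp
  then obtain D where D: "D \<subseteq> U" "detached (D \<union> ?A) ((U - D) \<union> ?B)"
    by (rule unlinked_split) (use sub in auto)
  have d: "detached (D \<union> ?A) (U - D)" "detached ((U - D) \<union> ?B) D" "detached D (U - D)"
    using D(2) detached_commute by (auto intro: detached_mono[OF D(2)] detached_mono[of "(U - D) \<union> ?B" "D \<union> ?A"])
  have e: "(D \<union> ?A) \<union> (U - D) = U \<union> ?A" "((U - D) \<union> ?B) \<union> D = U \<union> ?B" "D \<union> (U - D) = U"
    using D(1) by auto
  have "tight (D \<union> ?A)" "tight ((U - D) \<union> ?B)"
    using tight_detached[OF _ d(1)] tight_detached[OF _ d(2)] a(5) b(5) unfolding e by auto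
  then have "card (D \<union> ?A) \<le> 2 * alpha (D \<union> ?A)" "card ((U - D) \<union> ?B) \<le> 2 * alpha ((U - D) \<union> ?B)"
    using D(1) U_subset sub by (auto intro!: tight_card_le)
  moreover have "alpha (U \<union> ?A) = alpha (D \<union> ?A) + alpha (U - D)"
    "alpha (U \<union> ?B) = alpha ((U - D) \<union> ?B) + alpha D" "alpha U = alpha D + alpha (U - D)"
    using alpha_Un_detached[OF d(1)] alpha_Un_detached[OF d(2)] alpha_Un_detached[OF d(3)] unfolding e by auto
  moreover have "card (D \<union> ?A) = card D + card ?A" "card ((U - D) \<union> ?B) = card (U - D) + card ?B"
    using D(1) sub finite_U finite_subset[OF D(1) finite_U] by (auto intro!: card_Un_disjoint)
  moreover have "card U = card D + card (U - D)"
    using D(1) finite_U by (metis card_Diff_subset card_mono finite_subset le_add_diff_inverse)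
  moreover have "card ?B \<ge> 2"
    using follow_cycle(1)[OF z'(1)] by (simp add: cycle_list_def simple_path_append distinct_card simple_path_distinct)
  ultimately show False using a(1,4) b(1) by linarith
qed

text \<open>
  A critical vertex has at most one absorbing neighbour.  If it has one, and also a neighbour in \<open>U\<close>, then a second
  critical vertex of the same component serves instead: the one absorbed cycle does not touch it.
\<close>

lemma unbalanced_case:
  "\<exists>v I. indep I \<and> I \<subseteq> V \<and> v \<in> I \<and> alpha U + card (nbrs_in V v) \<le> card I + 1"
proof -
  have "U \<noteq> {}" using unbalanced by auto
  then obtain v0 where "v0 \<in> U" by blast
  then obtain v where "v \<in> U" "alpha (U - {v}) < alpha U" "card (nbrs_in U v) \<le> 1"
    using tight_critical_leaf[OF tight_U U_subset unbalanced] by blast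
  then have v: "critical v" "v \<in> U" by (auto simp: critical_def)
  have good: ?thesis
    if w: "critical w" "card (nbrs_in U w) + card {z \<in> V - U. adj w z \<and> absorbing w z} \<le> 1" for w
    using good_vertex[OF _ swap_free_critical w(2)] w(1) by (auto simp: critical_def)
  let ?B = "{z \<in> V - U. adj v z \<and> absorbing v z}"
  show ?thesis
  proof (cases "?B = {}")
    case True
    then have "card ?B = 0" by (simp only: card.empty)
    then show ?thesis using good[OF v(1)] v(1) by (simp add: critical_def)
  next
    case False
    then obtain z where z: "z \<in> V - U" "adj v z" "absorbing v z" by blast
    have "?B = {z}"
      using z absorbing_critical_unique[OF v(1) v(1) component_self[OF v(2)] _ _ _ z] by blast
    then have B: "card ?B = 1" by simp
    show ?thesis
    proof (cases "nbrs_in U v = {}")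
      case True
      then show ?thesis using good[OF v(1)] B by simp
    next
      case False
      let ?T = "component U v"
      have TV: "?T \<subseteq> V" using component_subset U_subset by blast
      have finT: "finite ?T" using TV finite_V finite_subset by blast
      have vT: "v \<in> ?T" by (rule component_self[OF v(2)])
      have "?T \<union> (U - ?T) = U" using component_subset by blast
      then have tT: "tight ?T" using tight_detached[OF _ detached_component[of U v]] tight_U by simp
      have "alpha (U - {v}) < alpha U" using v(1) by (simp add: critical_def)
      then have crit: "alpha (?T - {v}) + 1 \<le> alpha ?T"
        using alpha_component_critical[OF v(2)] by simp
      have "alpha {v} \<le> 1" by (rule alpha_clique) auto
      then have "tight (?T - {v})" by (rule tight_diff_clique[OF tT crit])
      then have "card (?T - {v}) \<le> 2 * alpha (?T - {v})" using TV by (intro tight_card_le) auto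
      moreover have "card ?T = Suc (card (?T - {v}))" using vT finT by (metis card.remove)
      ultimately have "card ?T \<noteq> 2 * alpha ?T" using crit by linarith
      then obtain w where w: "w \<in> ?T" "alpha (?T - {w}) < alpha ?T" "card (nbrs_in ?T w) \<le> 1"
        "w \<noteq> v \<or> nbrs_in ?T w = {}"
        using tight_critical_leaf[OF tT TV _ vT] by blast
      have nw: "nbrs_in ?T w = nbrs_in U w" by (rule nbrs_in_component[OF w(1)])
      have wv: "w \<noteq> v" using w(4) nw False by auto
      have "alpha (U - {w}) \<le> alpha (?T - {w}) + alpha (U - ?T)"
        by (rule order_trans[OF alpha_mono alpha_Un_le]) auto
      then have "alpha (U - {w}) < alpha U" using w(2) alpha_component_split[of v] by linarith
      then have cw: "critical w" using w nw component_subset by (auto simp: critical_def)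
      have "\<not> absorbing w z'" if z': "z' \<in> V - U" "adj w z'" for z'
      proof
        assume ab: "absorbing w z'"
        have "z = z'" by (rule absorbing_critical_unique[OF v(1) cw w(1) z z' ab])
        then show False using absorbing_critical(3)[OF v(1) z w(1) wv] z'(2) by simp
      qed
      then have "{z' \<in> V - U. adj w z' \<and> absorbing w z'} = {}" by blast
      then have "card {z' \<in> V - U. adj w z' \<and> absorbing w z'} = 0" by (simp only: card.empty)
      then show ?thesis using good[OF cw] cw by (simp add: critical_def)
    qed
  qed
qed

end
end

context finite_simple_graph begin

text \<open>
  All optimal remainders have the same independence number, so the argument may pass from \<open>U\<close> to a more
  suitable one.
\<close>

theorem independent_set_of_optimal:
  assumes "optimal U" "U \<noteq> {}"
  shows "\<exists>v I. indep I \<and> I \<subseteq> V \<and> v \<in> I \<and> alpha U + card (nbrs_in V v) \<le> card I + 1"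
proof -
  have loc: "\<exists>follow. optimal_remainder V adj W follow" if W: "optimal W" for W
  proof -
    obtain follow where "oriented (V - W) follow"
      using cycle_coverable_oriented[of "V - W"] W unfolding optimal_def cycle_remainder_def by blast
    then show ?thesis using W
      by (intro exI[of _ follow]) (simp add: optimal_remainder_def optimal_remainder_axioms_def finite_simple_graph_axioms)
  qed
  show ?thesis
  proof (cases "\<forall>W. optimal W \<longrightarrow> card W = 2 * alpha W")
    case True
    obtain follow where "optimal_remainder V adj U follow" using loc[OF assms(1)] by blast
    then show ?thesis using optimal_remainder.balanced_case[of V adj U follow] True assms(2) by blast
  next
    case False
    let ?P = "\<lambda>W. optimal W \<and> card W \<noteq> 2 * alpha W"
    obtain W0 where "?P W0" using False by blast
    moreover have "\<forall>W. ?P W \<longrightarrow> card W < Suc (card V)"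
      using finite_V by (auto simp: optimal_def cycle_remainder_def less_Suc_eq_le intro: card_mono)
    ultimately have "\<exists>W. ?P W \<and> (\<forall>W'. ?P W' \<longrightarrow> card W' \<le> card W)" by (rule ex_has_greatest_nat)
    then obtain W where W: "optimal W" "card W \<noteq> 2 * alpha W" "\<And>W'. ?P W' \<Longrightarrow> card W' \<le> card W" by blast
    obtain follow where "optimal_remainder V adj W follow" using loc[OF W(1)] by blast
    then have "\<exists>v I. indep I \<and> I \<subseteq> V \<and> v \<in> I \<and> alpha W + card (nbrs_in V v) \<le> card I + 1"
      using optimal_remainder.unbalanced_case[of V adj W follow] W by blast
    moreover have "alpha W = alpha U" using W(1) assms(1) by (simp add: optimal_def order_antisym)
    ultimately show ?thesis by simp
  qed
qed

end

section \<open>Building the pseudo 2-factor\<close>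

text \<open>
  Cyclically consecutive entries.  A list of length two yields both arcs of an edge, and a singleton yields
  only a loop, which no graph contains; so one definition covers \<open>K\<^sub>1\<close>, \<open>K\<^sub>2\<close> and the cycles.
\<close>

definition ring_edges :: "'a list \<Rightarrow> ('a \<times> 'a) set" where
  "ring_edges xs = {(xs ! i, xs ! j) | i j. i < length xs \<and> j < length xs \<and>
     (j = Suc i mod length xs \<or> i = Suc j mod length xs)}"

lemma ring_edges_sym: "(a, b) \<in> ring_edges xs \<Longrightarrow> (b, a) \<in> ring_edges xs"
  unfolding ring_edges_def by blast

lemma ring_edges_set: "(a, b) \<in> ring_edges xs \<Longrightarrow> a \<in> set xs \<and> b \<in> set xs"
  unfolding ring_edges_def by auto

lemma ring_edges_single: "ring_edges [a] = {(a, a)}"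
  by (auto simp: ring_edges_def)

lemma ring_edges_pair: "ring_edges [a, b] = {(a, b), (b, a)}"
proof
  have "([a, b] ! 0, [a, b] ! 1) \<in> ring_edges [a, b]" unfolding ring_edges_def mem_Collect_eq
    by (rule exI[of _ 0], rule exI[of _ 1]) simp
  then show "{(a, b), (b, a)} \<subseteq> ring_edges [a, b]" using ring_edges_sym[of a b "[a, b]"] by simp
qed (auto simp: ring_edges_def less_Suc_eq)

context finite_simple_graph begin

definition ring :: "'a list \<Rightarrow> bool" where
  "ring xs \<longleftrightarrow> xs \<noteq> [] \<and> simple_path xs \<and> set xs \<subseteq> V \<and> (3 \<le> length xs \<longrightarrow> adj (last xs) (hd xs))"

definition ring_partition :: "'a list set \<Rightarrow> 'a set \<Rightarrow> bool" where
  "ring_partition P X \<longleftrightarrow> finite P \<and> (\<forall>xs\<in>P. ring xs) \<and>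
     (\<forall>xs\<in>P. \<forall>ys\<in>P. xs \<noteq> ys \<longrightarrow> set xs \<inter> set ys = {}) \<and> (\<Union>xs\<in>P. set xs) = X"

definition short_rings :: "'a list set \<Rightarrow> 'a list set" where
  "short_rings P = {xs \<in> P. length xs \<le> 2}"

lemma cycle_list_imp_ring: "cycle_list xs \<Longrightarrow> ring xs"
  by (auto simp: cycle_list_def ring_def)

lemma ring_partition_Un:
  assumes "ring_partition P X" "ring_partition Q Y" "X \<inter> Y = {}"
  shows "ring_partition (P \<union> Q) (X \<union> Y)"
proof -
  have sub: "set xs \<subseteq> X" if "xs \<in> P" for xs using assms(1) that by (auto simp: ring_partition_def)
  have sub': "set xs \<subseteq> Y" if "xs \<in> Q" for xs using assms(2) that by (auto simp: ring_partition_def)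
  have "set xs \<inter> set ys = {}" if xy: "xs \<in> P \<union> Q" "ys \<in> P \<union> Q" "xs \<noteq> ys" for xs ys
  proof -
    consider "xs \<in> P" "ys \<in> P" | "xs \<in> P" "ys \<in> Q" | "xs \<in> Q" "ys \<in> P" | "xs \<in> Q" "ys \<in> Q"
      using xy(1,2) by blast
    then show ?thesis
    proof cases
      case 1 then show ?thesis using assms(1) xy(3) by (simp add: ring_partition_def)
    next
      case 2 then show ?thesis using sub sub' assms(3) by (meson disjoint_iff subsetD)
    next
      case 3 then show ?thesis using sub sub' assms(3) by (meson disjoint_iff subsetD)
    next
      case 4 then show ?thesis using assms(2) xy(3) by (simp add: ring_partition_def)
    qed
  qed
  then show ?thesis using assms(1,2) by (auto simp: ring_partition_def)
qed

lemma ring_partition_insert: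
  assumes "ring xs" "ring_partition P X" "set xs \<inter> X = {}"
  shows "ring_partition (insert xs P) (set xs \<union> X)"
proof -
  have "ring_partition {xs} (set xs)" using assms(1) by (simp add: ring_partition_def)
  from ring_partition_Un[OF this assms(2,3)] show ?thesis by simp
qed

lemma cycle_coverable_ring_partition: "cycle_coverable X \<Longrightarrow> \<exists>P. ring_partition P X \<and> short_rings P = {}"
proof (induction rule: cycle_coverable.induct)
  case cycle_coverable_empty
  then show ?case by (intro exI[of _ "{}"]) (auto simp: ring_partition_def short_rings_def)
next
  case (cycle_coverable_Un xs X)
  then obtain P where P: "ring_partition P X" "short_rings P = {}" by blast
  have "ring_partition (insert xs P) (set xs \<union> X)"
    by (rule ring_partition_insert[OF cycle_list_imp_ring[OF cycle_coverable_Un.hyps(1)] P(1)]) fact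
  moreover have "short_rings (insert xs P) = {}" using P(2) cycle_coverable_Un.hyps(1) by (auto simp: short_rings_def cycle_list_def)
  ultimately show ?case by blast
qed

text \<open>
  Posa's theorem: the closed sets around path ends are removed one after the other, and each removal lowers
  \<open>alpha\<close>.
\<close>

lemma alpha_ring_partition:
  assumes "U \<subseteq> V" shows "\<exists>P. ring_partition P U \<and> card (short_rings P) \<le> alpha U"
  using assms
proof (induction "card U" arbitrary: U rule: less_induct)
  case less
  have fin: "finite U" using less.prems finite_V finite_subset by blast
  show ?case
  proof (cases "U = {}")
    case True
    then show ?thesis by (intro exI[of _ "{}"]) (auto simp: ring_partition_def short_rings_def)
  next
    case False
    then obtain v0 where "v0 \<in> U" by blast
    then obtain v X where vX: "v \<in> X" "X \<subseteq> U" "nbrs_in U v \<subseteq> X"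
      "X = {v} \<or> (\<exists>p. adj v p \<and> X = {v, p}) \<or> (\<exists>xs. cycle_list xs \<and> set xs = X)"
      using closed_nbhd_of_path_end[OF less.prems] by metis
    have "\<exists>xs. ring xs \<and> set xs = X"
      using vX(4)
    proof (elim disjE exE conjE)
      assume "X = {v}"
      then show ?thesis using vX less.prems by (intro exI[of _ "[v]"]) (auto simp: ring_def)
    next
      fix p assume "adj v p" "X = {v, p}"
      then show ?thesis using vX less.prems adj_irrefl
        by (intro exI[of _ "[v, p]"]) (auto simp: ring_def simple_path_Cons)
    next
      fix xs assume "cycle_list xs" "set xs = X"
      then show ?thesis using cycle_list_imp_ring by blast
    qed
    then obtain xs where xs: "ring xs" "set xs = X" by blast
    have "card (U - X) < card U" using vX fin by (intro psubset_card_mono) auto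
    then obtain P where P: "ring_partition P (U - X)" "card (short_rings P) \<le> alpha (U - X)"
      using less.hyps[of "U - X"] less.prems by auto
    have "ring_partition (insert xs P) (X \<union> (U - X))"
      using ring_partition_insert[OF xs(1) P(1)] xs(2) by simp
    moreover have "X \<union> (U - X) = U" using vX by blast
    moreover have "card (short_rings (insert xs P)) \<le> alpha U"
    proof -
      have "alpha (U - X) + 1 \<le> alpha U"
        using vX less.prems by (intro alpha_diff_closed_nbhd[of v]) auto
      moreover have "short_rings (insert xs P) \<subseteq> insert xs (short_rings P)" by (auto simp: short_rings_def)
      moreover have "finite (short_rings P)" using P(1) by (simp add: ring_partition_def short_rings_def)
      ultimately have "card (short_rings (insert xs P)) \<le> Suc (card (short_rings P))"
        using card_mono[of "insert xs (short_rings P)" "short_rings (insert xs P)"]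
        by (simp add: card_insert_if split: if_splits)
      then show ?thesis using P(2) \<open>alpha (U - X) + 1 \<le> alpha U\<close> by simp
    qed
    ultimately show ?thesis by metis
  qed
qed

lemma remainder_ring_partition:
  assumes "cycle_remainder U" shows "\<exists>P. ring_partition P V \<and> card (short_rings P) \<le> alpha U"
proof -
  obtain P where P: "ring_partition P U" "card (short_rings P) \<le> alpha U"
    using alpha_ring_partition assms by (auto simp: cycle_remainder_def)
  obtain Q where Q: "ring_partition Q (V - U)" "short_rings Q = {}"
    using cycle_coverable_ring_partition[of "V - U"] assms unfolding cycle_remainder_def by blast
  have "ring_partition (P \<union> Q) (U \<union> (V - U))" by (rule ring_partition_Un[OF P(1) Q(1)]) auto
  moreover have "U \<union> (V - U) = V" using assms by (auto simp: cycle_remainder_def)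
  moreover have "short_rings (P \<union> Q) = short_rings P" using Q(2) by (auto simp: short_rings_def)
  ultimately show ?thesis using P(2) by metis
qed

lemma ring_edges_adj:
  assumes "ring xs" "(a, b) \<in> ring_edges xs" "a \<noteq> b" shows "adj a b"
proof -
  let ?n = "length xs"
  have key: "adj (xs ! i) (xs ! j)" if "i < ?n" "j < ?n" "j = Suc i mod ?n" "xs ! i \<noteq> xs ! j" for i j
  proof (cases "Suc i < ?n")
    case True
    then have "j = Suc i" using that by simp
    moreover have "successively adj xs" using assms(1) by (simp add: ring_def simple_path_def)
    ultimately show ?thesis using True by (simp add: successively_conv_nth)
  next
    case False
    then have "Suc i = ?n" using that(1) by simp
    then have ij: "i = ?n - 1" "j = 0" using that(3) by auto
    then have e: "xs ! i = last xs" "xs ! j = hd xs" using assms(1)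
      by (auto simp: ring_def last_conv_nth hd_conv_nth)
    consider "?n = 1" | "?n = 2" | "?n \<ge> 3" using \<open>Suc i = ?n\<close> by linarith
    then show ?thesis
    proof cases
      case 1 then show ?thesis using that ij by simp
    next
      case 2
      have "successively adj xs" using assms(1) by (simp add: ring_def simple_path_def)
      then have "adj (xs ! 0) (xs ! 1)" using 2 by (simp add: successively_conv_nth)
      then show ?thesis using ij 2 adj_sym by simp
    next
      case 3 then show ?thesis using assms(1) e by (simp add: ring_def)
    qed
  qed
  obtain i j where ij: "a = xs ! i" "b = xs ! j" "i < ?n" "j < ?n" "j = Suc i mod ?n \<or> i = Suc j mod ?n"
    using assms(2) by (auto simp: ring_edges_def)
  show ?thesis using ij(5)
  proof
    assume "j = Suc i mod ?n" then show ?thesis using key[OF ij(3,4)] ij(1,2) assms(3) by simp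
  next
    assume "i = Suc j mod ?n"
    then have "adj (xs ! j) (xs ! i)" using key[OF ij(4,3)] ij(1,2) assms(3) by simp
    then show ?thesis using adj_sym ij(1,2) by simp
  qed
qed

end

sublocale graph \<subseteq> adjacency: finite_simple_graph "verts G" "\<lambda>u v. u \<rightarrow>\<^bsub>G\<^esub> v"
proof
  show "finite (verts G)" by simp
  show "v \<rightarrow> u" if "u \<rightarrow> v" for u v using that sym_arcs by (rule arcs_ends_symmetric[rotated])
  show "\<not> u \<rightarrow> u" for u using adj_not_same by blast
  show "u \<in> verts G" if "u \<rightarrow> v" for u v using that by (rule adj_in_verts)
qed

definition ring_graph :: "('a, 'b) pre_digraph \<Rightarrow> 'a list set \<Rightarrow> ('a, 'b) pre_digraph" where
  "ring_graph G P = \<lparr> verts = verts G,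
     arcs = {e \<in> arcs G. \<exists>xs\<in>P. (tail G e, head G e) \<in> ring_edges xs}, tail = tail G, head = head G \<rparr>"

lemma ring_graph_simps [simp]:
  "verts (ring_graph G P) = verts G" "tail (ring_graph G P) = tail G" "head (ring_graph G P) = head G"
  "arcs (ring_graph G P) = {e \<in> arcs G. \<exists>xs\<in>P. (tail G e, head G e) \<in> ring_edges xs}"
  by (simp_all add: ring_graph_def)

lemma dominates_ring_graph:
  "u \<rightarrow>\<^bsub>ring_graph G P\<^esub> v \<longleftrightarrow> u \<rightarrow>\<^bsub>G\<^esub> v \<and> (\<exists>xs\<in>P. (u, v) \<in> ring_edges xs)"
  by (auto simp: arcs_ends_conv)

context graph begin

lemma ring_graph_spanning: "spanning (ring_graph G P) G"
proof -
  have "wf_digraph (ring_graph G P)" by unfold_locales auto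
  then show ?thesis unfolding spanning_def subgraph_def compatible_def using wf_digraph by auto
qed

lemma ring_graph_graph: "graph (ring_graph G P)"
proof -
  have s: "subgraph (ring_graph G P) G" using ring_graph_spanning by (simp add: spanning_def)
  then interpret H: digraph "ring_graph G P" by (rule digraph_subgraph)
  have "symmetric (ring_graph G P)"
    unfolding symmetric_def sym_def using adjacency.adj_sym ring_edges_sym
    by (fastforce simp: dominates_ring_graph)
  then show ?thesis by (rule H.graphI)
qed

lemma ring_reachable:
  assumes P: "adjacency.ring_partition P (verts G)" and xs: "xs \<in> P" and ij: "i < length xs" "j < length xs"
  shows "xs ! i \<rightarrow>\<^sup>*\<^bsub>ring_graph G P\<^esub> xs ! j"
proof -
  interpret H: graph "ring_graph G P" by (rule ring_graph_graph)
  have r: "adjacency.ring xs" using P xs by (simp add: adjacency.ring_partition_def)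
  have up: "xs ! 0 \<rightarrow>\<^sup>*\<^bsub>ring_graph G P\<^esub> xs ! k" if "k < length xs" for k
    using that
  proof (induction k)
    case 0
    have "xs ! 0 \<in> verts (ring_graph G P)" using r 0 by (auto simp: adjacency.ring_def)
    then show ?case by blast
  next
    case (Suc k)
    have "xs ! k \<noteq> xs ! Suc k" using r Suc.prems
      by (simp add: adjacency.ring_def adjacency.simple_path_def nth_eq_iff_index_eq)
    moreover have e: "(xs ! k, xs ! Suc k) \<in> ring_edges xs"
      unfolding ring_edges_def mem_Collect_eq
      by (rule exI[of _ k], rule exI[of _ "Suc k"]) (use Suc.prems in simp)
    ultimately have "xs ! k \<rightarrow>\<^bsub>G\<^esub> xs ! Suc k" using adjacency.ring_edges_adj[OF r] by blast
    then have "xs ! k \<rightarrow>\<^bsub>ring_graph G P\<^esub> xs ! Suc k" using e xs by (auto simp: dominates_ring_graph)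
    then show ?case using Suc by (auto intro: H.reachable_adj_trans)
  qed
  have "xs ! i \<rightarrow>\<^sup>*\<^bsub>ring_graph G P\<^esub> xs ! 0" using up[OF ij(1)] by (rule H.symmetric_reachable')
  then show ?thesis using up[OF ij(2)] by (rule H.reachable_trans)
qed

lemma ring_graph_sccs:
  assumes P: "adjacency.ring_partition P (verts G)" and C: "C \<in> pre_digraph.sccs (ring_graph G P)"
  shows "\<exists>xs\<in>P. C = ring_graph G P \<restriction> set xs"
proof -
  let ?H = "ring_graph G P"
  interpret H: graph ?H by (rule ring_graph_graph)
  obtain S where S: "S \<in> H.sccs_verts" "C = ?H \<restriction> S" using C by (auto simp: H.sccs_conv_sccs_verts)
  then obtain u where u: "u \<in> S" by (auto simp: H.sccs_verts_def)
  then have "u \<rightarrow>\<^sup>*\<^bsub>?H\<^esub> u" using S(1) by (auto simp: H.sccs_verts_def)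
  then have "u \<in> verts G" by (auto elim: reachable_in_vertsE)
  then obtain xs where xs: "xs \<in> P" "u \<in> set xs"
    using P unfolding adjacency.ring_partition_def by blast
  have stay: "w \<in> set xs" if "u \<rightarrow>\<^sup>*\<^bsub>?H\<^esub> w" for w
    using that
  proof (induction rule: H.reachable_induct)
    case base show ?case by (rule xs(2))
  next
    case (step x y)
    then obtain ys where ys: "ys \<in> P" "(x, y) \<in> ring_edges ys" by (auto simp: dominates_ring_graph)
    then have "x \<in> set ys" "y \<in> set ys" using ring_edges_set[of x y ys] by blast+
    moreover have "ys = xs"
      using P ys(1) xs(1) step.IH \<open>x \<in> set ys\<close> unfolding adjacency.ring_partition_def
      by (meson disjoint_iff)
    ultimately show ?case by simp
  qed
  have reach: "a \<rightarrow>\<^sup>*\<^bsub>?H\<^esub> b" if "a \<in> set xs" "b \<in> set xs" for a b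
    using ring_reachable[OF P xs(1)] that by (metis in_set_conv_nth)
  have "S = set xs"
  proof
    show "S \<subseteq> set xs" using S(1) u stay by (auto simp: H.sccs_verts_def)
    show "set xs \<subseteq> S" using S(1) u reach xs(2) unfolding H.sccs_verts_def by blast
  qed
  then show ?thesis using S(2) xs(1) by blast
qed

lemma ring_component:
  assumes P: "adjacency.ring_partition P (verts G)" and xs: "xs \<in> P"
  defines "C \<equiv> ring_graph G P \<restriction> set xs"
  shows "graph C" and "arcs_ends C = {(a, b) \<in> ring_edges xs. a \<noteq> b}" and "card (verts C) = length xs"
proof -
  let ?H = "ring_graph G P"
  interpret H: graph ?H by (rule ring_graph_graph)
  have r: "adjacency.ring xs" using P xs by (simp add: adjacency.ring_partition_def)
  have "set xs \<subseteq> verts ?H" using r by (simp add: adjacency.ring_def)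
  then have ind: "induced_subgraph C ?H" unfolding C_def by (rule H.induced_induce)
  then interpret C: digraph C by (rule H.digraph_subgraph[OF induced_imp_subgraph])
  have "sym_digraph C" using ind by (rule H.induced_graph_imp_graph)
  then have "symmetric C" by (rule sym_digraph.sym_arcs)
  then show "graph C" by (rule C.graphI)
  show "card (verts C) = length xs"
    using r by (simp add: C_def adjacency.ring_def adjacency.simple_path_def distinct_card)
  have "(a, b) \<in> arcs_ends C \<longleftrightarrow> (a, b) \<in> ring_edges xs \<and> a \<noteq> b" for a b
  proof -
    have "(a, b) \<in> arcs_ends C \<longleftrightarrow> a \<rightarrow>\<^bsub>?H\<^esub> b \<and> a \<in> set xs \<and> b \<in> set xs"
      by (auto simp: C_def arcs_ends_conv)
    also have "\<dots> \<longleftrightarrow> (a, b) \<in> ring_edges xs \<and> a \<noteq> b"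
    proof
      assume h: "a \<rightarrow>\<^bsub>?H\<^esub> b \<and> a \<in> set xs \<and> b \<in> set xs"
      then obtain ys where ys: "ys \<in> P" "(a, b) \<in> ring_edges ys" by (auto simp: dominates_ring_graph)
      then have "a \<in> set ys" using ring_edges_set[of a b ys] by blast
      then have "ys = xs" using h ys(1) xs P unfolding adjacency.ring_partition_def by blast
      then show "(a, b) \<in> ring_edges xs \<and> a \<noteq> b"
        using ys(2) h adjacency.adj_irrefl by (auto simp: dominates_ring_graph)
    next
      assume h: "(a, b) \<in> ring_edges xs \<and> a \<noteq> b"
      then have "a \<rightarrow>\<^bsub>G\<^esub> b" using adjacency.ring_edges_adj[OF r] by blast
      then show "a \<rightarrow>\<^bsub>?H\<^esub> b \<and> a \<in> set xs \<and> b \<in> set xs"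
        using h xs ring_edges_set[of a b xs] by (auto simp: dominates_ring_graph)
    qed
    finally show ?thesis .
  qed
  then show "arcs_ends C = {(a, b) \<in> ring_edges xs. a \<noteq> b}" by auto
qed

text \<open>
  The isomorphism sends a vertex to its position in the list.
\<close>

lemma long_ring_is_cycle:
  assumes P: "adjacency.ring_partition P (verts G)" and xs: "xs \<in> P" "3 \<le> length xs"
  shows "is_cycle_graph (ring_graph G P \<restriction> set xs)"
proof -
  let ?C = "ring_graph G P \<restriction> set xs" and ?n = "length xs"
  note c = ring_component[OF P xs(1)]
  interpret C: graph ?C by (rule c(1))
  have dist: "distinct xs"
    using P xs by (simp add: adjacency.ring_partition_def adjacency.ring_def adjacency.simple_path_def)
  define ix where "ix = the_inv_into {..<?n} ((!) xs)"
  have inj: "inj_on ((!) xs) {..<?n}" using dist by (simp add: inj_on_def nth_eq_iff_index_eq)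
  have ix: "ix (xs ! i) = i" if "i < ?n" for i
    unfolding ix_def using the_inv_into_f_f[OF inj] that by simp
  have ix_inj: "inj_on ix (set xs)"
    by (rule inj_onI) (metis in_set_conv_nth ix)
  have ix_im: "ix ` set xs = {..<?n}"
    using ix by (force simp: in_set_conv_nth)
  define f where "f = \<lparr> iso_verts = ix, iso_arcs = (\<lambda>e. (ix (tail G e), ix (head G e))),
    iso_head = snd, iso_tail = fst \<rparr>"
  have "inj_on (iso_arcs f) (arcs ?C)"
  proof (rule inj_onI)
    fix e e' assume e: "e \<in> arcs ?C" "e' \<in> arcs ?C" "iso_arcs f e = iso_arcs f e'"
    then have "tail G e = tail G e'" "head G e = head G e'"
      using ix_inj by (auto simp: f_def dest: inj_onD)
    then show "e = e'" using e by (intro C.no_multi_arcs) (auto simp: arc_to_ends_def)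
  qed
  then have iso: "C.digraph_isomorphism f"
    unfolding C.digraph_isomorphism_def using C.wf_digraph ix_inj by (simp add: f_def)
  have suc: "i \<noteq> Suc i mod ?n" if "i < ?n" for i
    using that xs(2) by (cases "Suc i = ?n") auto
  have ne: "xs ! i \<noteq> xs ! j" if "i < ?n" "j < ?n" "j = Suc i mod ?n \<or> i = Suc j mod ?n" for i j
    using that suc dist by (metis nth_eq_iff_index_eq)
  have "iso_arcs f ` arcs ?C = map_prod ix ix ` arcs_ends ?C"
    by (auto simp: f_def arcs_ends_conv image_image)
  also have "\<dots> = parcs (cycle_graph ?n)"
    unfolding c(2)
  proof (intro equalityI subsetI)
    fix x assume "x \<in> map_prod ix ix ` {(a, b) \<in> ring_edges xs. a \<noteq> b}"
    then show "x \<in> parcs (cycle_graph ?n)"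
      using ix by (auto simp: ring_edges_def cycle_graph_def)
  next
    fix x assume "x \<in> parcs (cycle_graph ?n)"
    then obtain i j where ij: "x = (i, j)" "i < ?n" "j < ?n" "j = Suc i mod ?n \<or> i = Suc j mod ?n"
      by (auto simp: cycle_graph_def)
    have "(xs ! i, xs ! j) \<in> {(a, b) \<in> ring_edges xs. a \<noteq> b}"
      using ij ne unfolding ring_edges_def by blast
    moreover have "x = map_prod ix ix (xs ! i, xs ! j)" using ij ix by simp
    ultimately show "x \<in> map_prod ix ix ` {(a, b) \<in> ring_edges xs. a \<noteq> b}" by (rule rev_image_eqI)
  qed
  finally have "with_proj (cycle_graph ?n) = app_iso f ?C"
    using ix_im by (simp add: app_iso_def with_proj_def f_def cycle_graph_def)
  then show ?thesis unfolding is_cycle_graph_def digraph_iso_def using iso xs(2) by blast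
qed

lemma short_ring_is_complete:
  assumes P: "adjacency.ring_partition P (verts G)" and xs: "xs \<in> P" "length xs \<le> 2"
  shows "complete_digraph (length xs) (ring_graph G P \<restriction> set xs)"
proof -
  note c = ring_component[OF P xs(1)]
  have r: "adjacency.ring xs" using P xs by (simp add: adjacency.ring_partition_def)
  then have "xs \<noteq> []" by (simp add: adjacency.ring_def)
  then consider a where "xs = [a]" | a b where "xs = [a, b]"
    using xs(2) by (cases xs; cases "tl xs") auto
  then have "{(a, b) \<in> ring_edges xs. a \<noteq> b} = {(u, v). (u, v) \<in> set xs \<times> set xs \<and> u \<noteq> v}"
    by cases (auto simp: ring_edges_pair ring_edges_single)
  then show ?thesis unfolding complete_digraph_def using c by simp
qed

lemma ring_graph_pseudo_2_factor:
  assumes P: "adjacency.ring_partition P (verts G)"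
  shows "pseudo_2_factor (ring_graph G P) G"
    and "card (non_cycle_components (ring_graph G P)) \<le> card (adjacency.short_rings P)"
proof -
  let ?H = "ring_graph G P"
  have "complete_digraph 1 C \<or> complete_digraph 2 C \<or> is_cycle_graph C"
    if C: "C \<in> pre_digraph.sccs ?H" for C
  proof -
    obtain xs where xs: "xs \<in> P" "C = ?H \<restriction> set xs" using ring_graph_sccs[OF P C] by blast
    have "xs \<noteq> []" using P xs(1) by (auto simp: adjacency.ring_partition_def adjacency.ring_def)
    then consider "length xs = 1" | "length xs = 2" | "3 \<le> length xs"
      by (cases xs rule: remdups_adj.cases) (auto simp: Suc_le_eq)
    then show ?thesis
      using short_ring_is_complete[OF P xs(1)] long_ring_is_cycle[OF P xs(1)] xs(2) by cases auto
  qed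
  then show "pseudo_2_factor ?H G"
    unfolding pseudo_2_factor_def using ring_graph_graph ring_graph_spanning by blast
  have "non_cycle_components ?H \<subseteq> (\<lambda>xs. ?H \<restriction> set xs) ` adjacency.short_rings P"
  proof
    fix C assume "C \<in> non_cycle_components ?H"
    then have C: "C \<in> pre_digraph.sccs ?H" "complete_digraph 1 C \<or> complete_digraph 2 C"
      by (auto simp: non_cycle_components_def)
    obtain xs where xs: "xs \<in> P" "C = ?H \<restriction> set xs" using ring_graph_sccs[OF P C(1)] by blast
    have "card (verts C) \<le> 2" using C(2) by (auto simp: complete_digraph_def)
    then have "xs \<in> adjacency.short_rings P"
      using ring_component(3)[OF P xs(1)] xs by (simp add: adjacency.short_rings_def)
    then show "C \<in> (\<lambda>xs. ?H \<restriction> set xs) ` adjacency.short_rings P" using xs(2) by blast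
  qed
  moreover have "finite (adjacency.short_rings P)"
    using P by (simp add: adjacency.ring_partition_def adjacency.short_rings_def)
  ultimately show "card (non_cycle_components ?H) \<le> card (adjacency.short_rings P)"
    by (meson card_image_le card_mono finite_imageI le_trans)
qed

lemma out_degree_eq: "out_degree G v = card (adjacency.nbrs_in (verts G) v)"
proof -
  have "head G ` out_arcs G v = adjacency.nbrs_in (verts G) v"
    unfolding adjacency.nbrs_in_def by (auto simp: arcs_ends_conv)
  moreover have "inj_on (head G) (out_arcs G v)"
    by (rule inj_onI) (auto simp: arc_to_ends_def intro: no_multi_arcs)
  ultimately show ?thesis unfolding out_degree_def by (metis card_image)
qed

lemma f_param_ge:
  assumes "independent_set G I" "v \<in> I"
  shows "int (card I) - int (out_degree G v) + 1 \<le> f_param G"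
proof -
  let ?F = "\<lambda>I. int (card I) - int (min_degree_on G I) + 1"
  have I: "I \<subseteq> verts G" using assms(1) by (simp add: independent_set_def)
  have "finite (out_degree G ` I)" using I finite_verts finite_subset by blast
  then have "min_degree_on G I \<le> out_degree G v" unfolding min_degree_on_def using assms(2) by simp
  moreover have "?F I \<le> f_param G"
    unfolding f_param_def
  proof (rule Max_ge)
    have "{?F I | I. I \<noteq> {} \<and> independent_set G I} \<subseteq> ?F ` Pow (verts G)"
      by (auto simp: independent_set_def)
    then show "finite {?F I | I. I \<noteq> {} \<and> independent_set G I}"
      by (rule finite_subset) simp
    show "?F I \<in> {?F I | I. I \<noteq> {} \<and> independent_set G I}" using assms by blast
  qed
  ultimately show ?thesis by linarith
qed

end

theorem theorem4:
  fixes G :: "('a, 'b) pre_digraph"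
  assumes "graph G" and "verts G \<noteq> {}"
  shows "\<exists>H. pseudo_2_factor H G \<and>
    int (card (non_cycle_components H)) \<le> max 0 (f_param G)"
proof -
  interpret graph G by (rule assms(1))
  obtain U where U: "adjacency.optimal U" using adjacency.optimal_exists by blast
  then have "adjacency.cycle_remainder U" by (simp add: adjacency.optimal_def)
  then obtain P where P: "adjacency.ring_partition P (verts G)"
    "card (adjacency.short_rings P) \<le> adjacency.alpha U"
    using adjacency.remainder_ring_partition by blast
  have "int (adjacency.alpha U) \<le> max 0 (f_param G)"
  proof (cases "U = {}")
    case False
    obtain v I where I: "adjacency.indep I" "I \<subseteq> verts G" "v \<in> I"
      "adjacency.alpha U + card (adjacency.nbrs_in (verts G) v) \<le> card I + 1"
      using adjacency.independent_set_of_optimal[OF U False] by blast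
    have "independent_set G I"
      using I(1,2) by (auto simp: independent_set_def pairwise_def adjacency.indep_def)
    then have "int (card I) - int (out_degree G v) + 1 \<le> f_param G" using I(3) by (rule f_param_ge)
    then show ?thesis using I(4) out_degree_eq[of v] by linarith
  qed simp
  then show ?thesis
    using ring_graph_pseudo_2_factor[OF P(1)] P(2) by (intro exI[of _ "ring_graph G P"]) linarith
qed

end
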